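(* For every simplex collection $\mathcal S$, every $N\in\mathbb N$ and every $\Phi\in\mathcal F^+(N)$, the procedure $\mathcal A^+(\Phi,N,\mathcal S)$ described in the context returns an upper margin $\overline m(\Phi)$ of $\Phi$ with respect to $\mathcal S$, and it satisfies the second-order property $\overline m(\Phi)=O'(\tau^2)$.
   Context: Simplexes. Let $n\in\mathbb N=\{1,2,\dots\}$, let $\mathbb X\subset\mathbb R^n$ be a bounded closed set containing the origin, and let $\widetilde{\mathbb X}\subset\mathbb R^n$ be a bounded open set containing $\mathbb X$. A simplex collection $\mathcal S=(\mathbb X_i)_{i\in\mathcal I}$ consists of a finite set $\mathcal I\subset\mathbb N$ and, for each $i\in\mathcal I$, vertices $x_{i,1},\dots,x_{i,n+1}\in\mathbb X$ such that $x_{i,j}-x_{i,n+1}$, $j=1,\dots,n$, are linearly independent; with $x_i(w):=\sum_{j=1}^{n+1}w_jx_{i,j}$ and $\mathbb X_i:=\{x_i(w): w_j\ge 0\ \forall j,\ \sum_{j=1}^{n+1}w_j=1\}$, it is required that $\mathbb X=\bigcup_{i\in\mathcal I}\mathbb X_i$. Its maximum sampling interval is $\tau:=\max_{i,j,j'}\|x_{i,j}-x_{i,j'}\|$. For continuous $\xi:\widetilde{\mathbb X}\to\mathbb R$, the linear interpolation $\xi^{\mathrm I}:\mathbb X\to\mathbb R$ with respect to $\mathcal S$ is given by $\xi^{\mathrm I}(x_i(w)):=\sum_{j}w_j\xi(x_{i,j})$ for all $i$ and all $x_i(w)\in\mathbb X_i$ (simplex collections are understood to fit together so that this is well defined). Margins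 and order. Lower and upper margins of $\xi$ with respect to $\mathcal S$ are any numbers $\underline m(\xi)\ge0$, $\overline m(\xi)\ge 0$ with $-\underline m(\xi)\le \xi(x)-\xi^{\mathrm I}(x)\le\overline m(\xi)$ for all $x\in\mathbb X$ (not unique). For $p\in\mathbb N$, a scalar $m$ depending on $\mathcal S$ satisfies $m=O'(\tau^p)$ if there exist $\bar\tau>0$, $C>0$ such that for every simplex collection with maximum sampling interval $\tau$, $\tau\le\bar\tau$ implies $|m|\le C\tau^p$. Constants. Given margins of $\xi$: $\underline b(\xi):=\min_{i,j}\xi(x_{i,j})-\underline m(\xi)$, $\overline b(\xi):=\max_{i,j}\xi(x_{i,j})+\overline m(\xi)$, and $g(\xi):=\max_{i,j,j'}|\xi(x_{i,j})-\xi(x_{i,j'})|/\tau$. Function classes. Let $T\in\mathbb N$ be a predefined number. "Known" means that the object in question can be identified from the form of the function and given information. For continuous $y:\widetilde{\mathbb X}\to\mathbb R$ write $\mathbb Y:=\{y(x):x\in\mathbb X\}$ and $\mathbb Y^{\mathrm I}:=\{y^{\mathrm I}(x):x\in\mathbb X\}$, and consider functions $h:\widetilde{\mathbb Y}\to\mathbb R$ satisfying (H1): $\widetilde{\mathbb Y}\subseteq\mathbb R$ is an open set containing $\{y(x):x\in\widetilde{\mathbb X}\}$. $\mathcal H(y)$ is the set of $h$ satisfying (H1) and (H2): $h$ is $C^2$, there are known constants (not depending on $\mathcal S$) with $\underline{\partial}(h)\le h'(\tilde y)\le\overline{\partial}(h)$ for all $\tilde y\in\mathbb Y$, and for some $C_h>0$,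 for every $\mathcal S$ there are known constants with $\underline{\partial^2}(h)\le h''(\tilde y)\le\overline{\partial^2}(h)$ for all $\tilde y\in\mathbb Y^{\mathrm I}$ and $|\underline{\partial^2}(h)|+|\overline{\partial^2}(h)|<C_h$. $\mathcal H_{\mathrm{ndec}}(y)$ is the set of $h$ satisfying (H1) and (H3): $h$ is monotonically nondecreasing and $C^2$, and for some $C_h>0$, for every $\mathcal S$ there are known constants $\underline{\partial^2}(h),\overline\partial(h)$ with $\underline{\partial^2}(h)\le h''(\tilde y)$ for all $\tilde y\in\mathbb Y^{\mathrm I}$, $h'(\tilde y)\le\overline\partial(h)$ for all $\tilde y\in[\min\mathbb Y^{\mathrm I},\max\mathbb Y]$, and $|\underline{\partial^2}(h)|+|\overline\partial(h)|<C_h$. $\mathcal H_{\mathrm{conv}}(y)$ is the set of $h$ satisfying (H1) and (H4): $h$ is convex and Lipschitz continuous with a known Lipschitz constant $h_{\mathrm{Lip}}\ge0$ (differentiability not needed). $\mathcal F(1)$ is the set of $C^2$ functions $\xi:\widetilde{\mathbb X}\to\mathbb R$ for which there are known constants with $\underline{d^2}(\xi)\le \frac{\partial^2}{\partial\chi^2}\xi(x+\chi\nu)\big|_{\chi=0}\le\overline{d^2}(\xi)$ for all $x\in\mathbb X$ and all $\nu\in\mathbb R^n$ with $\|\nu\|=1$. For $N\ge2$, $\mathcal F(N)$ is the set of $\Phi:\widetilde{\mathbb X}\to\mathbb R$ for which there are known $\phi_s,\psi_s\in\mathcal F(N-1)$, $s=1,\dots,T$, and $h\in\mathcal H(y)$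 with ( * ) $\Phi(x)=h(y(x))$, $y(x)=\sum_{s=1}^T\phi_s(x)\psi_s(x)$. $\mathcal F_{\ge0}$ is the set of functions $\widetilde{\mathbb X}\to[0,\infty)$. $\mathcal F^+(1):=\mathcal F(1)\cap\mathcal F_{\ge0}$. For $N\ge2$: $\mathcal F^+_{\mathrm{ndec}}(N)$ is the set of $\Phi\in\mathcal F_{\ge0}$ for which there are known $\phi_s,\psi_s\in\mathcal F^+(N-1)$ and $h\in\mathcal H_{\mathrm{ndec}}(y)$ with ( * ); $\mathcal F^+_{\mathrm{conv}}(N)$ is the set of $\Phi\in\mathcal F_{\ge0}$ for which there are known $\phi_s,\psi_s\in\mathcal F(N-1)$ and $h\in\mathcal H_{\mathrm{conv}}(y)$ with ( * ); $\mathcal F^+(N):=\mathcal F^+_{\mathrm{ndec}}(N)\cup\mathcal F^+_{\mathrm{conv}}(N)$. Procedures. The data witnessing membership in the classes (decompositions, functions $h$, constants) are fixed for each function independently of $\mathcal S$, except that the bounds explicitly allowed to depend on $\mathcal S$ in (H2), (H3) may do so, subject to the bound $C_h$. $\mathcal A(\Phi,N,\mathcal S)$ for $\Phi\in\mathcal F(N)$. Step 0: for $\xi\in\mathcal F(1)$ set $\underline m(\xi)=\frac{n\tau^2}{8}\max\{0,\overline{d^2}(\xi)\}$, $\overline m(\xi)=\frac{n\tau^2}{8}\max\{0,-\underline{d^2}(\xi)\}$, and compute $\underline b(\xi),\overline b(\xi),g(\xi)$; if $N=1$ return these. If $N\ge2$: decompose $\Phi$ by ( * ); obtain the five constants of each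 $\xi\in\{\phi_s,\psi_s\}$ by Step 0 if $\xi\in\mathcal F(1)$ and by $\mathcal A(\xi,N-1,\mathcal S)$ otherwise. With $\underline a(\phi,\psi):=\max\{\underline m(\phi)\overline b(\psi),-\overline m(\phi)\underline b(\psi)\}$, $\overline a(\phi,\psi):=\max\{\overline m(\phi)\overline b(\psi),-\underline m(\phi)\underline b(\psi)\}$, set (P) $\underline m(y)=\sum_s(\underline a(\phi_s,\psi_s)+\underline a(\psi_s,\phi_s)+\tau^2g(\phi_s)g(\psi_s))$, $\overline m(y)=\sum_s(\overline a(\phi_s,\psi_s)+\overline a(\psi_s,\phi_s)+\tau^2g(\phi_s)g(\psi_s))$, then $\underline m(\Phi)=\max\{-\overline m(y)\underline\partial(h),\underline m(y)\overline\partial(h)\}+\tau^2\frac{n g(y)^2}{8}\max\{0,\overline{\partial^2}(h)\}$, $\overline m(\Phi)=\max\{-\underline m(y)\underline\partial(h),\overline m(y)\overline\partial(h)\}+\tau^2\frac{n g(y)^2}{8}\max\{0,-\underline{\partial^2}(h)\}$, and compute $\underline b(\Phi),\overline b(\Phi),g(\Phi)$. $\mathcal A^+(\Phi,N,\mathcal S)$ for $\Phi\in\mathcal F^+(N)$, returning $\overline m(\Phi),\overline b(\Phi),g(\Phi)$. If $N=1$, use Step 0. If $N\ge2$: decompose $\Phi$ by ( * ) according to $\mathcal F^+_{\mathrm{ndec}}(N)$ or $\mathcal F^+_{\mathrm{conv}}(N)$. For each $\xi\in\{\phi_s,\psi_s\}$: use Step 0 if $\xi\in\mathcal F(1)$;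 else use $\mathcal A(\xi,N-1,\mathcal S)$ if $\xi\in\mathcal F(N-1)$; else use $\mathcal A^+(\xi,N-1,\mathcal S)$. Case ndec: set $\overline m(y)=\sum_s(\overline m(\phi_s)\overline b(\psi_s)+\overline m(\psi_s)\overline b(\phi_s)+\tau^2g(\phi_s)g(\psi_s))$ and $\overline m(\Phi)=\overline m(y)\overline\partial(h)+\tau^2\frac{n g(y)^2}{8}\max\{0,-\underline{\partial^2}(h)\}$. Case conv: set $\underline m(y),\overline m(y)$ by (P) and $\overline m(\Phi)=h_{\mathrm{Lip}}\max\{\underline m(y),\overline m(y)\}$. Finally compute $\overline b(\Phi),g(\Phi)$. *)

theory Defs
  imports "HOL-Analysis.Analysis"
begin

text \<open>
  The ambient space is \<open>real ^ 'n\<close>, with \<open>n = CARD('n)\<close>. Simplexes subdivide \<open>X\<close>; functions live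
  on an open set \<open>Xt\<close> containing \<open>X\<close>, and are given by total functions of which only the values on
  \<open>Xt\<close> matter.
\<close>

section \<open>Simplex collections\<close>

record 'a simplices =
  idx  :: "nat set"
  vert :: "nat \<Rightarrow> nat \<Rightarrow> 'a"

definition bary_weights :: "nat \<Rightarrow> (nat \<Rightarrow> real) \<Rightarrow> bool" where
  "bary_weights n w \<longleftrightarrow> (\<forall>j\<in>{1..n+1}. 0 \<le> w j) \<and> (\<Sum>j=1..n+1. w j) = 1"

definition pt :: "(real^'n) simplices \<Rightarrow> nat \<Rightarrow> (nat \<Rightarrow> real) \<Rightarrow> real^'n" where
  "pt S i w = (\<Sum>j=1..CARD('n)+1. w j *\<^sub>R vert S i j)"

definition simplex_of :: "(real^'n) simplices \<Rightarrow> nat \<Rightarrow> (real^'n) set" where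
  "simplex_of S i = {pt S i w |w. bary_weights CARD('n) w}"

definition interp_val ::
    "(real^'n) simplices \<Rightarrow> (real^'n \<Rightarrow> real) \<Rightarrow> nat \<Rightarrow> (nat \<Rightarrow> real) \<Rightarrow> real" where
  "interp_val S \<xi> i w = (\<Sum>j=1..CARD('n)+1. w j * \<xi> (vert S i j))"

text \<open>
  In the definition below, injectivity together with independence of the image is linear
  independence of the family of edge vectors; the last conjunct says that the simplexes fit
  together, i.e. that linear interpolation of continuous functions is well defined.
\<close>

definition simplex_collection ::
    "(real^'n) set \<Rightarrow> (real^'n) set \<Rightarrow> (real^'n) simplices \<Rightarrow> bool" where
  "simplex_collection X Xt S \<longleftrightarrow>
     finite (idx S) \<and> idx S \<subseteq> {1..} \<and>
     (\<forall>i\<in>idx S. \<forall>j\<in>{1..CARD('n)+1}. vert S i j \<in> X) \<and>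
     (\<forall>i\<in>idx S. inj_on (\<lambda>j. vert S i j - vert S i (CARD('n)+1)) {1..CARD('n)} \<and>
        independent ((\<lambda>j. vert S i j - vert S i (CARD('n)+1)) ` {1..CARD('n)})) \<and>
     X = (\<Union>i\<in>idx S. simplex_of S i) \<and>
     (\<forall>\<xi>. continuous_on Xt \<xi> \<longrightarrow>
        (\<forall>i\<in>idx S. \<forall>i'\<in>idx S. \<forall>w w'.
           bary_weights CARD('n) w \<and> bary_weights CARD('n) w' \<and> pt S i w = pt S i' w' \<longrightarrow>
           interp_val S \<xi> i w = interp_val S \<xi> i' w'))"

definition tau :: "(real^'n) simplices \<Rightarrow> real" where
  "tau S = Max {norm (vert S i j - vert S i j') |i j j'.
     i \<in> idx S \<and> j \<in> {1..CARD('n)+1} \<and> j' \<in> {1..CARD('n)+1}}"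

definition interp :: "(real^'n) simplices \<Rightarrow> (real^'n \<Rightarrow> real) \<Rightarrow> real^'n \<Rightarrow> real" where
  "interp S \<xi> x = (THE v. \<exists>i\<in>idx S. \<exists>w. bary_weights CARD('n) w \<and>
     x = pt S i w \<and> v = interp_val S \<xi> i w)"

section \<open>Margins, order, and constants\<close>

definition is_upper_margin ::
    "(real^'n) set \<Rightarrow> (real^'n) simplices \<Rightarrow> (real^'n \<Rightarrow> real) \<Rightarrow> real \<Rightarrow> bool" where
  "is_upper_margin X S \<xi> m \<longleftrightarrow> 0 \<le> m \<and> (\<forall>x\<in>X. \<xi> x - interp S \<xi> x \<le> m)"

definition is_Oprime ::
    "(real^'n) set \<Rightarrow> (real^'n) set \<Rightarrow> nat \<Rightarrow> ((real^'n) simplices \<Rightarrow> real) \<Rightarrow> bool" where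
  "is_Oprime X Xt p m \<longleftrightarrow>
     (\<exists>taubar>0. \<exists>C>0. \<forall>S. simplex_collection X Xt S \<and> tau S \<le> taubar \<longrightarrow> \<bar>m S\<bar> \<le> C * tau S ^ p)"

definition verts :: "(real^'n) simplices \<Rightarrow> (real^'n) set" where
  "verts S = {vert S i j |i j. i \<in> idx S \<and> j \<in> {1..CARD('n)+1}}"

definition gconst :: "(real^'n) simplices \<Rightarrow> (real^'n \<Rightarrow> real) \<Rightarrow> real" where
  "gconst S \<xi> = Max {\<bar>\<xi> (vert S i j) - \<xi> (vert S i j')\<bar> / tau S |i j j'.
     i \<in> idx S \<and> j \<in> {1..CARD('n)+1} \<and> j' \<in> {1..CARD('n)+1}}"

record three_consts =
  m_hi :: real
  b_hi :: real
  gval :: real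

record five_consts = three_consts +
  m_lo :: real
  b_lo :: real

definition mk_upper :: "(real^'n) simplices \<Rightarrow> (real^'n \<Rightarrow> real) \<Rightarrow> real \<Rightarrow> three_consts" where
  "mk_upper S \<xi> mhi = \<lparr>m_hi = mhi, b_hi = Max (\<xi> ` verts S) + mhi, gval = gconst S \<xi>\<rparr>"

definition mk_consts :: "(real^'n) simplices \<Rightarrow> (real^'n \<Rightarrow> real) \<Rightarrow> real \<Rightarrow> real \<Rightarrow> five_consts" where
  "mk_consts S \<xi> mlo mhi =
     \<lparr>m_hi = mhi, b_hi = Max (\<xi> ` verts S) + mhi, gval = gconst S \<xi>,
      m_lo = mlo, b_lo = Min (\<xi> ` verts S) - mlo\<rparr>"

section \<open>Outer functions\<close>

text \<open>Twice continuously differentiable on an open set, in the sense of Frechet derivatives.\<close>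

definition C2_on :: "'a::real_normed_vector set \<Rightarrow> ('a \<Rightarrow> real) \<Rightarrow> bool" where
  "C2_on U f \<longleftrightarrow>
     (\<exists>(f' :: 'a \<Rightarrow> 'a \<Rightarrow>\<^sub>L real) (f'' :: 'a \<Rightarrow> 'a \<Rightarrow>\<^sub>L ('a \<Rightarrow>\<^sub>L real)).
        (\<forall>x\<in>U. (f has_derivative blinfun_apply (f' x)) (at x)) \<and>
        (\<forall>x\<in>U. (f' has_derivative blinfun_apply (f'' x)) (at x)) \<and>
        continuous_on U f'')"

text \<open>
  An outer function h comes with its domain and its known bounds. Those bounds that may depend on
  the simplex collection are functions of it.
\<close>

record H_fun =
  hdom :: "real set"
  hfun :: "real \<Rightarrow> real"

record 'a H_data = H_fun +
  dlo  :: real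
  dhi  :: real
  d2lo :: "'a simplices \<Rightarrow> real"
  d2hi :: "'a simplices \<Rightarrow> real"

record 'a ndec_data = H_fun +
  ndec_d2lo :: "'a simplices \<Rightarrow> real"
  ndec_dhi  :: "'a simplices \<Rightarrow> real"

record conv_data = H_fun +
  hLip :: real

definition H1 :: "(real^'n) set \<Rightarrow> (real^'n \<Rightarrow> real) \<Rightarrow> 'z H_fun_scheme \<Rightarrow> bool" where
  "H1 Xt y h \<longleftrightarrow> open (hdom h) \<and> y ` Xt \<subseteq> hdom h"

definition in_H ::
    "(real^'n) set \<Rightarrow> (real^'n) set \<Rightarrow> (real^'n \<Rightarrow> real) \<Rightarrow> (real^'n) H_data \<Rightarrow> bool" where
  "in_H X Xt y h \<longleftrightarrow>
     H1 Xt y h \<and> C2_on (hdom h) (hfun h) \<and>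
     (\<forall>t\<in>y ` X. dlo h \<le> deriv (hfun h) t \<and> deriv (hfun h) t \<le> dhi h) \<and>
     (\<exists>C>0. \<forall>S. simplex_collection X Xt S \<longrightarrow>
        (\<forall>t\<in>interp S y ` X. d2lo h S \<le> deriv (deriv (hfun h)) t \<and>
                             deriv (deriv (hfun h)) t \<le> d2hi h S) \<and>
        \<bar>d2lo h S\<bar> + \<bar>d2hi h S\<bar> < C)"

text \<open>
  The infimum and supremum below are attained, since X is compact. The interval they span need not
  be contained in the domain of h (X may be disconnected); the bound on the derivative is required
  wherever h is defined.
\<close>

definition in_H_ndec ::
    "(real^'n) set \<Rightarrow> (real^'n) set \<Rightarrow> (real^'n \<Rightarrow> real) \<Rightarrow> (real^'n) ndec_data \<Rightarrow> bool" where
  "in_H_ndec X Xt y h \<longleftrightarrow>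
     H1 Xt y h \<and> mono_on (hdom h) (hfun h) \<and> C2_on (hdom h) (hfun h) \<and>
     (\<exists>C>0. \<forall>S. simplex_collection X Xt S \<longrightarrow>
        (\<forall>t\<in>interp S y ` X. ndec_d2lo h S \<le> deriv (deriv (hfun h)) t) \<and>
        (\<forall>t\<in>{Inf (interp S y ` X)..Sup (y ` X)} \<inter> hdom h. deriv (hfun h) t \<le> ndec_dhi h S) \<and>
        \<bar>ndec_d2lo h S\<bar> + \<bar>ndec_dhi h S\<bar> < C)"

text \<open>
  The library's \<open>convex_on\<close> requires a convex domain, whereas the domain of h is only assumed open;
  convexity is therefore required on the convex parts of the domain. If the domain is an interval,
  this is \<open>convex_on (hdom h) (hfun h)\<close>.
\<close>

definition in_H_conv ::
    "(real^'n) set \<Rightarrow> (real^'n \<Rightarrow> real) \<Rightarrow> conv_data \<Rightarrow> bool" where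
  "in_H_conv Xt y h \<longleftrightarrow>
     H1 Xt y h \<and> (\<forall>J. convex J \<and> J \<subseteq> hdom h \<longrightarrow> convex_on J (hfun h)) \<and>
     (hLip h)-lipschitz_on (hdom h) (hfun h)"

section \<open>Function classes\<close>

text \<open>
  "Known" is modelled by a knowledge base: a partial assignment of data to functions, fixed once
  and for all, hence independent of the simplex collection. A function belongs to a class if the
  knowledge base holds data for it that witness the membership. Replacing "known" by mere existence
  would make every C2 function a member of the base class (X is compact), so that the recursion in
  the procedures would collapse to the base step.

  The second-derivative bounds are keyed by the function, the decompositions by the level N
  and the function. A function may have both an ndec and a conv decomposition; then \<open>prefer_ndec\<close>
  says which of the two the procedure uses.
\<close>

record ('a, 'h) decomp =
  phi   :: "nat \<Rightarrow> 'a \<Rightarrow> real"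
  psi   :: "nat \<Rightarrow> 'a \<Rightarrow> real"
  outer :: 'h

record 'a knowledge =
  known_d2    :: "('a \<Rightarrow> real) \<Rightarrow> (real \<times> real) option"
  known_F     :: "nat \<Rightarrow> ('a \<Rightarrow> real) \<Rightarrow> ('a, 'a H_data) decomp option"
  known_ndec  :: "nat \<Rightarrow> ('a \<Rightarrow> real) \<Rightarrow> ('a, 'a ndec_data) decomp option"
  known_conv  :: "nat \<Rightarrow> ('a \<Rightarrow> real) \<Rightarrow> ('a, conv_data) decomp option"
  prefer_ndec :: "nat \<Rightarrow> ('a \<Rightarrow> real) \<Rightarrow> bool"

definition inner_sum :: "nat \<Rightarrow> ('a, 'h) decomp \<Rightarrow> 'a \<Rightarrow> real" where
  "inner_sum T D x = (\<Sum>s=1..T. phi D s x * psi D s x)"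

definition class_F1 ::
    "(real^'n) set \<Rightarrow> (real^'n) set \<Rightarrow> (real^'n) knowledge \<Rightarrow> (real^'n \<Rightarrow> real) set" where
  "class_F1 X Xt K = {\<xi>. C2_on Xt \<xi> \<and>
     (\<exists>lo hi. known_d2 K \<xi> = Some (lo, hi) \<and>
        (\<forall>x\<in>X. \<forall>\<nu>. norm \<nu> = 1 \<longrightarrow>
           lo \<le> deriv (deriv (\<lambda>t. \<xi> (x + t *\<^sub>R \<nu>))) 0 \<and>
           deriv (deriv (\<lambda>t. \<xi> (x + t *\<^sub>R \<nu>))) 0 \<le> hi))}"

fun class_F ::
    "nat \<Rightarrow> (real^'n) set \<Rightarrow> (real^'n) set \<Rightarrow> (real^'n) knowledge \<Rightarrow> nat \<Rightarrow> (real^'n \<Rightarrow> real) set" where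
  "class_F T X Xt K 0 = {}"
| "class_F T X Xt K (Suc 0) = class_F1 X Xt K"
| "class_F T X Xt K (Suc (Suc N)) = {\<Phi>. \<exists>D. known_F K (Suc (Suc N)) \<Phi> = Some D \<and>
     (\<forall>s\<in>{1..T}. phi D s \<in> class_F T X Xt K (Suc N) \<and> psi D s \<in> class_F T X Xt K (Suc N)) \<and>
     in_H X Xt (inner_sum T D) (outer D) \<and>
     (\<forall>x\<in>Xt. \<Phi> x = hfun (outer D) (inner_sum T D x))}"

definition nonneg_funs :: "(real^'n) set \<Rightarrow> (real^'n \<Rightarrow> real) set" where
  "nonneg_funs Xt = {\<Phi>. \<forall>x\<in>Xt. 0 \<le> \<Phi> x}"

text \<open>
  The set \<open>G\<close> in \<open>class_F_ndec\<close> stands for \<open>class_F_plus\<close> at level \<open>N - 1\<close>, which is passed as an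
  argument to avoid a mutual recursion.
\<close>

definition class_F_ndec ::
    "nat \<Rightarrow> (real^'n) set \<Rightarrow> (real^'n) set \<Rightarrow> (real^'n) knowledge \<Rightarrow> (real^'n \<Rightarrow> real) set \<Rightarrow>
     nat \<Rightarrow> (real^'n \<Rightarrow> real) set" where
  "class_F_ndec T X Xt K G N = {\<Phi> \<in> nonneg_funs Xt.
     \<exists>D. known_ndec K N \<Phi> = Some D \<and>
       (\<forall>s\<in>{1..T}. phi D s \<in> G \<and> psi D s \<in> G) \<and>
       in_H_ndec X Xt (inner_sum T D) (outer D) \<and>
       (\<forall>x\<in>Xt. \<Phi> x = hfun (outer D) (inner_sum T D x))}"

definition class_F_conv ::
    "nat \<Rightarrow> (real^'n) set \<Rightarrow> (real^'n) set \<Rightarrow> (real^'n) knowledge \<Rightarrow>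
     nat \<Rightarrow> (real^'n \<Rightarrow> real) set" where
  "class_F_conv T X Xt K N = {\<Phi> \<in> nonneg_funs Xt.
     \<exists>D. known_conv K N \<Phi> = Some D \<and>
       (\<forall>s\<in>{1..T}. phi D s \<in> class_F T X Xt K (N - 1) \<and> psi D s \<in> class_F T X Xt K (N - 1)) \<and>
       in_H_conv Xt (inner_sum T D) (outer D) \<and>
       (\<forall>x\<in>Xt. \<Phi> x = hfun (outer D) (inner_sum T D x))}"

fun class_F_plus ::
    "nat \<Rightarrow> (real^'n) set \<Rightarrow> (real^'n) set \<Rightarrow> (real^'n) knowledge \<Rightarrow> nat \<Rightarrow> (real^'n \<Rightarrow> real) set" where
  "class_F_plus T X Xt K 0 = {}"
| "class_F_plus T X Xt K (Suc 0) = class_F T X Xt K 1 \<inter> nonneg_funs Xt"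
| "class_F_plus T X Xt K (Suc (Suc N)) =
     class_F_ndec T X Xt K (class_F_plus T X Xt K (Suc N)) (Suc (Suc N)) \<union>
     class_F_conv T X Xt K (Suc (Suc N))"

section \<open>Procedures\<close>

definition step0 :: "(real^'n) knowledge \<Rightarrow> (real^'n \<Rightarrow> real) \<Rightarrow> (real^'n) simplices \<Rightarrow> five_consts" where
  "step0 K \<xi> S =
     (let (lo, hi) = the (known_d2 K \<xi>) in
      mk_consts S \<xi>
        (real CARD('n) * (tau S)\<^sup>2 / 8 * max 0 hi)
        (real CARD('n) * (tau S)\<^sup>2 / 8 * max 0 (- lo)))"

definition a_lo :: "five_consts \<Rightarrow> five_consts \<Rightarrow> real" where
  "a_lo p q = max (m_lo p * b_hi q) (- m_hi p * b_lo q)"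

definition a_hi :: "five_consts \<Rightarrow> five_consts \<Rightarrow> real" where
  "a_hi p q = max (m_hi p * b_hi q) (- m_lo p * b_lo q)"

text \<open>
  The margins of the sum of products; the argument \<open>c\<close> yields the constants of the factors.
\<close>

definition sum_m_lo ::
    "nat \<Rightarrow> (real^'n) simplices \<Rightarrow> (real^'n, 'h) decomp \<Rightarrow> ((real^'n \<Rightarrow> real) \<Rightarrow> five_consts) \<Rightarrow> real" where
  "sum_m_lo T S D c = (\<Sum>s=1..T.
     a_lo (c (phi D s)) (c (psi D s)) + a_lo (c (psi D s)) (c (phi D s)) +
     (tau S)\<^sup>2 * gval (c (phi D s)) * gval (c (psi D s)))"

definition sum_m_hi ::
    "nat \<Rightarrow> (real^'n) simplices \<Rightarrow> (real^'n, 'h) decomp \<Rightarrow> ((real^'n \<Rightarrow> real) \<Rightarrow> five_consts) \<Rightarrow> real" where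
  "sum_m_hi T S D c = (\<Sum>s=1..T.
     a_hi (c (phi D s)) (c (psi D s)) + a_hi (c (psi D s)) (c (phi D s)) +
     (tau S)\<^sup>2 * gval (c (phi D s)) * gval (c (psi D s)))"

definition sum_m_hi_nonneg ::
    "nat \<Rightarrow> (real^'n) simplices \<Rightarrow> (real^'n, 'h) decomp \<Rightarrow>
     ((real^'n \<Rightarrow> real) \<Rightarrow> three_consts) \<Rightarrow> real" where
  "sum_m_hi_nonneg T S D c = (\<Sum>s=1..T.
     m_hi (c (phi D s)) * b_hi (c (psi D s)) + m_hi (c (psi D s)) * b_hi (c (phi D s)) +
     (tau S)\<^sup>2 * gval (c (phi D s)) * gval (c (psi D s)))"

text \<open>
  The composition steps of the procedures at level at least 2. The last argument \<open>c\<close> yields the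
  constants of the factors.
\<close>

definition compose_A ::
    "nat \<Rightarrow> (real^'n) simplices \<Rightarrow> (real^'n \<Rightarrow> real) \<Rightarrow> (real^'n, (real^'n) H_data) decomp \<Rightarrow>
     ((real^'n \<Rightarrow> real) \<Rightarrow> five_consts) \<Rightarrow> five_consts" where
  "compose_A T S \<Phi> D c =
     (let h = outer D;
          mlo_y = sum_m_lo T S D c;
          mhi_y = sum_m_hi T S D c;
          q = (tau S)\<^sup>2 * (real CARD('n) * (gconst S (inner_sum T D))\<^sup>2 / 8)
      in mk_consts S \<Phi>
           (max (- mhi_y * dlo h) (mlo_y * dhi h) + q * max 0 (d2hi h S))
           (max (- mlo_y * dlo h) (mhi_y * dhi h) + q * max 0 (- d2lo h S)))"

definition compose_ndec ::
    "nat \<Rightarrow> (real^'n) simplices \<Rightarrow> (real^'n \<Rightarrow> real) \<Rightarrow> (real^'n, (real^'n) ndec_data) decomp \<Rightarrow>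
     ((real^'n \<Rightarrow> real) \<Rightarrow> three_consts) \<Rightarrow> three_consts" where
  "compose_ndec T S \<Phi> D c =
     (let h = outer D;
          q = (tau S)\<^sup>2 * (real CARD('n) * (gconst S (inner_sum T D))\<^sup>2 / 8)
      in mk_upper S \<Phi> (sum_m_hi_nonneg T S D c * ndec_dhi h S + q * max 0 (- ndec_d2lo h S)))"

definition compose_conv ::
    "nat \<Rightarrow> (real^'n) simplices \<Rightarrow> (real^'n \<Rightarrow> real) \<Rightarrow> (real^'n, conv_data) decomp \<Rightarrow>
     ((real^'n \<Rightarrow> real) \<Rightarrow> five_consts) \<Rightarrow> three_consts" where
  "compose_conv T S \<Phi> D c =
     mk_upper S \<Phi> (hLip (outer D) * max (sum_m_lo T S D c) (sum_m_hi T S D c))"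

text \<open>Level 0 does not occur; the procedures are left undefined there.\<close>

fun proc_A ::
    "nat \<Rightarrow> (real^'n) set \<Rightarrow> (real^'n) set \<Rightarrow> (real^'n) knowledge \<Rightarrow>
     (real^'n \<Rightarrow> real) \<Rightarrow> nat \<Rightarrow> (real^'n) simplices \<Rightarrow> five_consts" where
  "proc_A T X Xt K \<Phi> 0 S = undefined"
| "proc_A T X Xt K \<Phi> (Suc 0) S = step0 K \<Phi> S"
| "proc_A T X Xt K \<Phi> (Suc (Suc N)) S =
     compose_A T S \<Phi> (the (known_F K (Suc (Suc N)) \<Phi>))
       (\<lambda>\<xi>. if \<xi> \<in> class_F T X Xt K 1 then step0 K \<xi> S else proc_A T X Xt K \<xi> (Suc N) S)"

definition uses_ndec ::
    "nat \<Rightarrow> (real^'n) set \<Rightarrow> (real^'n) set \<Rightarrow> (real^'n) knowledge \<Rightarrow>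
     (real^'n \<Rightarrow> real) \<Rightarrow> nat \<Rightarrow> bool" where
  "uses_ndec T X Xt K \<Phi> N \<longleftrightarrow>
     \<Phi> \<in> class_F_ndec T X Xt K (class_F_plus T X Xt K (N - 1)) N \<and>
     (prefer_ndec K N \<Phi> \<or> \<Phi> \<notin> class_F_conv T X Xt K N)"

text \<open>
  In the conv case all factors belong to \<open>class_F\<close> at level \<open>N - 1\<close>, so they never need a recursive
  call of \<open>proc_A_plus\<close>.
\<close>

fun proc_A_plus ::
    "nat \<Rightarrow> (real^'n) set \<Rightarrow> (real^'n) set \<Rightarrow> (real^'n) knowledge \<Rightarrow>
     (real^'n \<Rightarrow> real) \<Rightarrow> nat \<Rightarrow> (real^'n) simplices \<Rightarrow> three_consts" where
  "proc_A_plus T X Xt K \<Phi> 0 S = undefined"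
| "proc_A_plus T X Xt K \<Phi> (Suc 0) S = three_consts.truncate (step0 K \<Phi> S)"
| "proc_A_plus T X Xt K \<Phi> (Suc (Suc N)) S =
     (if uses_ndec T X Xt K \<Phi> (Suc (Suc N)) then
        compose_ndec T S \<Phi> (the (known_ndec K (Suc (Suc N)) \<Phi>))
          (\<lambda>\<xi>. if \<xi> \<in> class_F T X Xt K 1 then three_consts.truncate (step0 K \<xi> S)
               else if \<xi> \<in> class_F T X Xt K (Suc N)
                    then three_consts.truncate (proc_A T X Xt K \<xi> (Suc N) S)
               else proc_A_plus T X Xt K \<xi> (Suc N) S)
      else
        compose_conv T S \<Phi> (the (known_conv K (Suc (Suc N)) \<Phi>))
          (\<lambda>\<xi>. if \<xi> \<in> class_F T X Xt K 1 then step0 K \<xi> S else proc_A T X Xt K \<xi> (Suc N) S))"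

end

theory Submission
  imports Defs
begin

text \<open>
  On a simplex, interpolation is averaging over the vertices, so that \<open>\<xi> - \<xi>\<^sup>I\<close> at \<open>x = pt S i w\<close> is the
  gap between the value of \<open>\<xi>\<close> at a weighted mean and the weighted mean of its values. Three
  estimates of such gaps make up the procedures.

  For a smooth function, Taylor expansion at the mean kills the linear terms. The gap is at most
  half the curvature bound times the variance of the vertices (\<open>concave_gap_le\<close>, \<open>convex_gap_le\<close>), and
  the variance is a weighted sum of squared mutual distances (\<open>weighted_covariance\<close>), at most
  \<open>\<tau>\<^sup>2 / 2 * (1 - (\<Sum>j. (w j)\<^sup>2)) \<le> n \<tau>\<^sup>2 / 4\<close>. This is the base step with its constant \<open>n / 8\<close>.

  For a product \<open>\<phi> \<psi>\<close>, the gaps of the factors contribute \<open>(\<phi> - \<phi>\<^sup>I) \<psi> + (\<psi> - \<psi>\<^sup>I) \<phi>\<^sup>I\<close>, up to the covariance of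
  the vertex values, which is at most \<open>\<tau>\<^sup>2 g(\<phi>) g(\<psi>)\<close> (\<open>gap_product\<close>).

  For a composition, \<open>h(y) - (h \<circ> y)\<^sup>I = (h(y) - h(y\<^sup>I)) + (h(y\<^sup>I) - (h \<circ> y)\<^sup>I)\<close>. The first bracket is bounded
  by the mean value theorem or the Lipschitz constant, and for nondecreasing \<open>h\<close> only the positive
  part of \<open>y - y\<^sup>I\<close> matters. The second bracket is a gap of \<open>h\<close> on the real line, at points at most
  \<open>\<tau> g(y)\<close> apart; it is bounded by the first estimate (\<open>outer_curvature\<close>) or, for convex \<open>h\<close>, by Jensen's
  inequality (\<open>outer_jensen\<close>). All this takes place inside the image of one simplex under \<open>y\<close>, an
  interval on which \<open>h\<close> is defined.

  Each margin is thus a sum of terms with one factor that is \<open>\<tau>\<^sup>2\<close> or an earlier margin. The other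
  factors are bounded uniformly in the simplex collection, because all functions concerned are
  continuous and Lipschitz along segments in the compact set \<open>X\<close> (\<open>tame\<close>). Validity and order of the
  margins therefore propagate together through the levels (\<open>two_sided_proc_A\<close>,
  \<open>one_sided_proc_A_plus\<close>).
\<close>

section \<open>Weighted means\<close>

text \<open>
  The double sum in the second identity contains only differences between vertices, which is what
  the sampling interval and the constants \<open>g\<close> control. Taking \<open>p = q\<close> gives the variance that governs
  the gap of a smooth function; different \<open>p\<close> and \<open>q\<close> give the correction term for a product.
\<close>

lemma weighted_covariance:
  fixes p q :: "'i \<Rightarrow> 'a::real_inner" and w :: "'i \<Rightarrow> real"
  assumes "sum w I = 1"
  defines "P \<equiv> \<Sum>j\<in>I. w j *\<^sub>R p j" and "Q \<equiv> \<Sum>j\<in>I. w j *\<^sub>R q j"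
  shows "(\<Sum>j\<in>I. w j * ((p j - P) \<bullet> (q j - Q))) = (\<Sum>j\<in>I. w j * (p j \<bullet> q j)) - P \<bullet> Q"
    and "(\<Sum>j\<in>I. \<Sum>k\<in>I. w j * w k * ((p j - p k) \<bullet> (q j - q k)))
      = 2 * (\<Sum>j\<in>I. w j * ((p j - P) \<bullet> (q j - Q)))"
proof -
  let ?M = "\<Sum>j\<in>I. w j * (p j \<bullet> q j)"
  have PQ: "(\<Sum>j\<in>I. w j * (p j \<bullet> v)) = P \<bullet> v" "(\<Sum>j\<in>I. w j * (v \<bullet> q j)) = v \<bullet> Q" for v
    by (simp_all add: P_def Q_def inner_sum_left inner_sum_right)
  have "(\<Sum>j\<in>I. w j * ((p j - P) \<bullet> (q j - Q)))
      = ?M - (\<Sum>j\<in>I. w j * (p j \<bullet> Q)) - (\<Sum>j\<in>I. w j * (P \<bullet> q j)) + sum w I * (P \<bullet> Q)"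
    by (simp add: inner_diff_left inner_diff_right algebra_simps sum.distrib sum_subtractf
        sum_distrib_left sum_distrib_right)
  then show *: "(\<Sum>j\<in>I. w j * ((p j - P) \<bullet> (q j - Q))) = ?M - P \<bullet> Q"
    using assms(1) by (simp add: PQ)
  have inner_row: "(\<Sum>k\<in>I. w j * w k * ((p j - p k) \<bullet> (q j - q k)))
      = w j * (p j \<bullet> q j) - w j * (p j \<bullet> Q) - w j * (P \<bullet> q j) + w j * ?M" for j
  proof -
    have "(\<Sum>k\<in>I. w j * w k * ((p j - p k) \<bullet> (q j - q k)))
        = (\<Sum>k\<in>I. w j * (w k * (p j \<bullet> q j) - w k * (p j \<bullet> q k) - w k * (p k \<bullet> q j) + w k * (p k \<bullet> q k)))"
      by (intro sum.cong) (auto simp: inner_diff_left inner_diff_right algebra_simps)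
    also have "\<dots> = w j * (sum w I * (p j \<bullet> q j) - (\<Sum>k\<in>I. w k * (p j \<bullet> q k))
        - (\<Sum>k\<in>I. w k * (p k \<bullet> q j)) + ?M)"
      by (simp add: sum.distrib sum_subtractf sum_distrib_right flip: sum_distrib_left)
    also have "\<dots> = w j * (p j \<bullet> q j) - w j * (p j \<bullet> Q) - w j * (P \<bullet> q j) + w j * ?M"
      unfolding PQ using assms(1) by (simp add: algebra_simps)
    finally show ?thesis .
  qed
  have "(\<Sum>j\<in>I. \<Sum>k\<in>I. w j * w k * ((p j - p k) \<bullet> (q j - q k)))
      = ?M - (\<Sum>j\<in>I. w j * (p j \<bullet> Q)) - (\<Sum>j\<in>I. w j * (P \<bullet> q j)) + sum w I * ?M"
    unfolding inner_row by (simp add: sum.distrib sum_subtractf sum_distrib_right)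
  also have "\<dots> = 2 * (?M - P \<bullet> Q)"
    unfolding PQ using assms(1) by simp
  finally show "(\<Sum>j\<in>I. \<Sum>k\<in>I. w j * w k * ((p j - p k) \<bullet> (q j - q k)))
      = 2 * (\<Sum>j\<in>I. w j * ((p j - P) \<bullet> (q j - Q)))"
    unfolding * .
qed

text \<open>
  The diagonal of the double sum vanishes. Its weight, the sum of the squares, is therefore saved
  from the total weight 1; without this saving the bound would be too weak for the constant \<open>n / 8\<close>
  on a segment, where \<open>n = 1\<close>.
\<close>

lemma weighted_covariance_le:
  fixes p q :: "'i \<Rightarrow> 'a::real_inner" and w :: "'i \<Rightarrow> real"
  assumes I: "finite I" and w: "\<And>j. j \<in> I \<Longrightarrow> 0 \<le> w j" "sum w I = 1"
    and p: "\<And>j k. j \<in> I \<Longrightarrow> k \<in> I \<Longrightarrow> norm (p j - p k) \<le> d"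
    and q: "\<And>j k. j \<in> I \<Longrightarrow> k \<in> I \<Longrightarrow> norm (q j - q k) \<le> e"
  shows "\<bar>\<Sum>j\<in>I. w j * ((p j - (\<Sum>k\<in>I. w k *\<^sub>R p k)) \<bullet> (q j - (\<Sum>k\<in>I. w k *\<^sub>R q k)))\<bar>
    \<le> d * e / 2 * (1 - (\<Sum>j\<in>I. (w j)\<^sup>2))"
proof -
  let ?t = "\<lambda>j k. w j * w k * ((p j - p k) \<bullet> (q j - q k))"
  have t: "\<bar>?t j k\<bar> \<le> d * e * (w j * w k - (if k = j then (w j)\<^sup>2 else 0))"
    if jk: "j \<in> I" "k \<in> I" for j k
  proof (cases "k = j")
    case False
    have "\<bar>(p j - p k) \<bullet> (q j - q k)\<bar> \<le> norm (p j - p k) * norm (q j - q k)"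
      by (rule Cauchy_Schwarz_ineq2)
    also have "\<dots> \<le> d * e"
      using p[OF jk] q[OF jk] by (intro mult_mono) (auto intro: order_trans[OF norm_ge_zero])
    finally have "w j * w k * \<bar>(p j - p k) \<bullet> (q j - q k)\<bar> \<le> w j * w k * (d * e)"
      using w(1) jk by (intro mult_left_mono) auto
    then show ?thesis
      using False w(1) jk by (simp add: abs_mult mult_ac)
  qed (auto simp: power2_eq_square)
  have "\<bar>\<Sum>j\<in>I. \<Sum>k\<in>I. ?t j k\<bar> \<le> (\<Sum>j\<in>I. \<Sum>k\<in>I. \<bar>?t j k\<bar>)"
    by (rule order_trans[OF sum_abs]) (intro sum_mono sum_abs)
  also have "\<dots> \<le> (\<Sum>j\<in>I. \<Sum>k\<in>I. d * e * (w j * w k - (if k = j then (w j)\<^sup>2 else 0)))"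
    by (intro sum_mono t)
  also have "\<dots> = d * e * ((\<Sum>j\<in>I. \<Sum>k\<in>I. w j * w k) - (\<Sum>j\<in>I. (w j)\<^sup>2))"
    using I by (simp add: sum_subtractf flip: sum_distrib_left)
  also have "(\<Sum>j\<in>I. \<Sum>k\<in>I. w j * w k) = 1"
    using w(2) by (simp flip: sum_distrib_left)
  finally show ?thesis
    unfolding weighted_covariance(2)[OF w(2)] by simp
qed

text \<open>
  By the Cauchy-Schwarz inequality the squares sum to at least \<open>1 / (n + 1)\<close>, so the left side is at
  most \<open>n / (n + 1)\<close>; the weaker bound \<open>n / 2\<close> is the source of the factor \<open>n\<close> in the margins.
\<close>

lemma one_minus_sum_squares_le:
  fixes w :: "'i \<Rightarrow> real"
  assumes "finite I" "sum w I = 1" "card I = n + 1" "1 \<le> n"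
  shows "1 - (\<Sum>j\<in>I. (w j)\<^sup>2) \<le> real n / 2"
proof -
  have "(sum w I)\<^sup>2 \<le> (\<Sum>j\<in>I. (w j)\<^sup>2) * card I"
    using sum_squared_le_sum_of_squares[of w I] assms by (simp add: mult.commute)
  then have *: "1 \<le> (\<Sum>j\<in>I. (w j)\<^sup>2) * (real n + 1)"
    using assms by (simp add: add.commute)
  show ?thesis
  proof (rule ccontr)
    assume "\<not> ?thesis"
    then have "(\<Sum>j\<in>I. (w j)\<^sup>2) < 1 - n / 2" by simp
    then have "(\<Sum>j\<in>I. (w j)\<^sup>2) * (real n + 1) < (1 - n / 2) * (real n + 1)"
      by (intro mult_strict_right_mono) auto
    moreover have "(1 - n / 2) * (real n + 1) = 1 + real n / 2 - real n * real n / 2"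
      by (simp add: field_simps)
    ultimately have "real n * real n < real n" using * by linarith
    with assms show False by simp
  qed
qed

section \<open>Second-order Taylor estimates\<close>

lemma taylor_ge:
  fixes f :: "'a::real_normed_vector \<Rightarrow> real"
    and f' :: "'a \<Rightarrow> 'a \<Rightarrow>\<^sub>L real" and f'' :: "'a \<Rightarrow> 'a \<Rightarrow>\<^sub>L ('a \<Rightarrow>\<^sub>L real)"
  assumes f': "\<And>x. x \<in> U \<Longrightarrow> (f has_derivative blinfun_apply (f' x)) (at x)"
    and f'': "\<And>x. x \<in> U \<Longrightarrow> (f' has_derivative blinfun_apply (f'' x)) (at x)"
    and seg: "closed_segment x z \<subseteq> U"
    and c: "\<And>q. q \<in> closed_segment x z \<Longrightarrow> c \<le> f'' q (z - x) (z - x)"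
  shows "f x + f' x (z - x) + c / 2 \<le> f z"
proof -
  define v where "v = z - x"
  define g where "g m t = (if m = 0 then f (x + t *\<^sub>R v)
    else if m = 1 then f' (x + t *\<^sub>R v) v else f'' (x + t *\<^sub>R v) v v)" for m :: nat and t :: real
  have in_seg: "x + t *\<^sub>R v \<in> closed_segment x z" if "0 \<le> t" "t \<le> 1" for t
    using that by (auto simp: v_def closed_segment_def algebra_simps intro!: exI[of _ t])
  have line: "((\<lambda>t. x + t *\<^sub>R v) has_derivative (\<lambda>s. s *\<^sub>R v)) (at t)" for t :: real
    by (auto intro!: derivative_eq_intros)
  have g: "DERIV (g m) t :> g (Suc m) t" if "m < 2" "0 \<le> t" "t \<le> 1" for m t
  proof -
    have U: "x + t *\<^sub>R v \<in> U" using in_seg[of t] that seg by auto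
    have "((\<lambda>t. f (x + t *\<^sub>R v)) has_derivative (\<lambda>s. f' (x + t *\<^sub>R v) (s *\<^sub>R v))) (at t)"
      by (rule has_derivative_compose[OF line f'[OF U]])
    moreover have "((\<lambda>t. f' (x + t *\<^sub>R v) v) has_derivative
        (\<lambda>s. f'' (x + t *\<^sub>R v) (s *\<^sub>R v) v)) (at t)"
      by (rule bounded_linear.has_derivative[OF blinfun.bounded_linear_left
            has_derivative_compose[OF line f''[OF U]]])
    ultimately show ?thesis
      using that(1)
      by (cases m) (auto simp: g_def[abs_def] has_field_derivative_def blinfun.scaleR_right
        blinfun.scaleR_left mult.commute[of _ "_ :: real"] elim!: has_derivative_eq_rhs)
  qed
  obtain t where t: "0 < t" "t < 1"
    and eq: "g 0 1 = (\<Sum>m<2. g m 0 / fact m * (1 - 0) ^ m) + g 2 t / fact 2 * (1 - 0)\<^sup>2"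
    using Taylor_up[of 2 g "g 0" 0 1 0] g by auto
  have "c \<le> f'' (x + t *\<^sub>R v) v v"
    using c[OF in_seg[of t]] t by (simp add: v_def)
  with eq show ?thesis
    by (simp add: g_def lessThan_Suc numeral_2_eq_2 v_def)
qed

text \<open>
  Expand \<open>f\<close> at the mean \<open>P\<close> of the points: the constant terms give \<open>f P\<close>, the linear ones cancel, and
  the quadratic ones add up to the curvature bound times half the variance of the points, which is
  at most \<open>n d\<^sup>2 / 4\<close>. The lemma serves twice: for simplexes in space, and on the real line for an outer
  function at the values that the inner function takes at the vertices.
\<close>

lemma concave_gap_le:
  fixes f :: "'a::real_inner \<Rightarrow> real"
    and f' :: "'a \<Rightarrow> 'a \<Rightarrow>\<^sub>L real" and f'' :: "'a \<Rightarrow> 'a \<Rightarrow>\<^sub>L ('a \<Rightarrow>\<^sub>L real)"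
  assumes f': "\<And>x. x \<in> U \<Longrightarrow> (f has_derivative blinfun_apply (f' x)) (at x)"
    and f'': "\<And>x. x \<in> U \<Longrightarrow> (f' has_derivative blinfun_apply (f'' x)) (at x)"
    and C: "convex C" "C \<subseteq> U" "\<And>j. j \<in> I \<Longrightarrow> p j \<in> C"
    and lo: "\<And>q v. q \<in> C \<Longrightarrow> lo * (norm v)\<^sup>2 \<le> f'' q v v"
    and I: "finite I" "card I = n + 1" "1 \<le> n"
    and w: "\<And>j. j \<in> I \<Longrightarrow> 0 \<le> w j" "sum w I = 1"
    and d: "\<And>j k. j \<in> I \<Longrightarrow> k \<in> I \<Longrightarrow> norm (p j - p k) \<le> d"
  shows "f (\<Sum>j\<in>I. w j *\<^sub>R p j) - (\<Sum>j\<in>I. w j * f (p j)) \<le> real n * d\<^sup>2 / 8 * max 0 (- lo)"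
proof -
  define P where "P = (\<Sum>j\<in>I. w j *\<^sub>R p j)"
  have P: "P \<in> C" unfolding P_def using C I w by (intro convex_sum) auto
  let ?V = "\<Sum>j\<in>I. w j * (norm (p j - P))\<^sup>2"
  have V: "?V \<le> real n * d\<^sup>2 / 4"
  proof -
    have "?V = \<bar>\<Sum>j\<in>I. w j * ((p j - P) \<bullet> (p j - P))\<bar>"
      using w by (simp add: power2_norm_eq_inner sum_nonneg)
    also have "\<dots> \<le> d * d / 2 * (1 - (\<Sum>j\<in>I. (w j)\<^sup>2))"
      unfolding P_def by (rule weighted_covariance_le[OF I(1) w d d])
    also have "\<dots> \<le> d * d / 2 * (real n / 2)"
      using one_minus_sum_squares_le[OF I(1) w(2) I(2,3)] by (intro mult_left_mono) auto
    finally show ?thesis by (simp add: power2_eq_square mult_ac)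
  qed
  \<comment> \<open>Where the curvature is nonnegative it helps, and the bound \<open>lo\<close> may be replaced by 0.\<close>
  have summand: "w j * (f P + f' P (p j - P) - max 0 (- lo) / 2 * (norm (p j - P))\<^sup>2) \<le> w j * f (p j)"
    if j: "j \<in> I" for j
  proof (rule mult_left_mono)
    have "closed_segment P (p j) \<subseteq> C"
      using C P j by (intro closed_segment_subset) auto
    then have "f P + f' P (p j - P) + (lo * (norm (p j - P))\<^sup>2) / 2 \<le> f (p j)"
      using lo C by (intro taylor_ge[where U = U and f'' = f''] f' f'') auto
    moreover have "- max 0 (- lo) * (norm (p j - P))\<^sup>2 \<le> lo * (norm (p j - P))\<^sup>2"
      by (intro mult_right_mono) auto
    ultimately show "f P + f' P (p j - P) - max 0 (- lo) / 2 * (norm (p j - P))\<^sup>2 \<le> f (p j)"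
      by simp
  qed (use w j in auto)
  have lin: "(\<Sum>j\<in>I. w j * f' P (p j - P)) = 0"
  proof -
    have "(\<Sum>j\<in>I. w j * f' P (p j - P)) = f' P (\<Sum>j\<in>I. w j *\<^sub>R (p j - P))"
      by (simp add: blinfun.sum_right blinfun.scaleR_right)
    also have "(\<Sum>j\<in>I. w j *\<^sub>R (p j - P)) = 0"
      using w(2) by (simp add: P_def scaleR_diff_right sum_subtractf flip: scaleR_left.sum)
    finally show ?thesis by simp
  qed
  have "f P - max 0 (- lo) / 2 * ?V
      = sum w I * f P + (\<Sum>j\<in>I. w j * f' P (p j - P)) - max 0 (- lo) / 2 * ?V"
    using w lin by simp
  also have "\<dots> = (\<Sum>j\<in>I. w j * (f P + f' P (p j - P) - max 0 (- lo) / 2 * (norm (p j - P))\<^sup>2))"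
    by (simp add: algebra_simps sum.distrib sum_subtractf sum_distrib_left)
  also have "\<dots> \<le> (\<Sum>j\<in>I. w j * f (p j))"
    by (rule sum_mono) (rule summand)
  finally have "f P - (\<Sum>j\<in>I. w j * f (p j)) \<le> max 0 (- lo) / 2 * ?V" by simp
  also have "\<dots> \<le> max 0 (- lo) / 2 * (real n * d\<^sup>2 / 4)"
    using V by (intro mult_left_mono) auto
  finally show ?thesis by (simp add: P_def mult.commute)
qed

lemma convex_gap_le:
  fixes f :: "'a::real_inner \<Rightarrow> real"
    and f' :: "'a \<Rightarrow> 'a \<Rightarrow>\<^sub>L real" and f'' :: "'a \<Rightarrow> 'a \<Rightarrow>\<^sub>L ('a \<Rightarrow>\<^sub>L real)"
  assumes f': "\<And>x. x \<in> U \<Longrightarrow> (f has_derivative blinfun_apply (f' x)) (at x)"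
    and f'': "\<And>x. x \<in> U \<Longrightarrow> (f' has_derivative blinfun_apply (f'' x)) (at x)"
    and C: "convex C" "C \<subseteq> U" "\<And>j. j \<in> I \<Longrightarrow> p j \<in> C"
    and hi: "\<And>q v. q \<in> C \<Longrightarrow> f'' q v v \<le> hi * (norm v)\<^sup>2"
    and I: "finite I" "card I = n + 1" "1 \<le> n"
    and w: "\<And>j. j \<in> I \<Longrightarrow> 0 \<le> w j" "sum w I = 1"
    and d: "\<And>j k. j \<in> I \<Longrightarrow> k \<in> I \<Longrightarrow> norm (p j - p k) \<le> d"
  shows "(\<Sum>j\<in>I. w j * f (p j)) - f (\<Sum>j\<in>I. w j *\<^sub>R p j) \<le> real n * d\<^sup>2 / 8 * max 0 hi"
proof -
  have "(\<lambda>x. - f x) (\<Sum>j\<in>I. w j *\<^sub>R p j) - (\<Sum>j\<in>I. w j * (\<lambda>x. - f x) (p j))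
      \<le> real n * d\<^sup>2 / 8 * max 0 (- (- hi))"
  proof (rule concave_gap_le[where U = U and f' = "\<lambda>x. - f' x" and f'' = "\<lambda>x. - f'' x"])
    show "((\<lambda>x. - f x) has_derivative blinfun_apply (- f' x)) (at x)" if "x \<in> U" for x
      using has_derivative_minus[OF f'[OF that]]
      by (rule has_derivative_eq_rhs) (simp add: fun_eq_iff blinfun.minus_left)
    show "((\<lambda>x. - f' x) has_derivative blinfun_apply (- f'' x)) (at x)" if "x \<in> U" for x
      using has_derivative_minus[OF f''[OF that]]
      by (rule has_derivative_eq_rhs) (simp add: fun_eq_iff blinfun.minus_left)
    show "- hi * (norm v)\<^sup>2 \<le> (- f'' q) v v" if "q \<in> C" for q v
      using hi[OF that] by (simp add: blinfun.minus_left)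
  qed (fact C I w d)+
  then show ?thesis by (simp add: sum_negf)
qed

text \<open>
  This and the next lemma translate the bounds stated with \<open>deriv\<close> into bounds on the Hessian form.
\<close>

lemma second_directional_derivative:
  fixes f :: "'a::real_normed_vector \<Rightarrow> real"
    and f' :: "'a \<Rightarrow> 'a \<Rightarrow>\<^sub>L real" and f'' :: "'a \<Rightarrow> 'a \<Rightarrow>\<^sub>L ('a \<Rightarrow>\<^sub>L real)"
  assumes U: "open U" "x \<in> U"
    and f': "\<And>x. x \<in> U \<Longrightarrow> (f has_derivative blinfun_apply (f' x)) (at x)"
    and f'': "\<And>x. x \<in> U \<Longrightarrow> (f' has_derivative blinfun_apply (f'' x)) (at x)"
  shows "deriv (deriv (\<lambda>t. f (x + t *\<^sub>R v))) 0 = f'' x v v"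
proof -
  have line: "((\<lambda>t. x + t *\<^sub>R v) has_derivative (\<lambda>s. s *\<^sub>R v)) (at t)" for t :: real
    by (auto intro!: derivative_eq_intros)
  have d1: "deriv (\<lambda>t. f (x + t *\<^sub>R v)) t = f' (x + t *\<^sub>R v) v" if "x + t *\<^sub>R v \<in> U" for t
  proof (rule DERIV_imp_deriv)
    have "((\<lambda>t. f (x + t *\<^sub>R v)) has_derivative (\<lambda>s. f' (x + t *\<^sub>R v) (s *\<^sub>R v))) (at t)"
      by (rule has_derivative_compose[OF line f'[OF that]])
    then show "DERIV (\<lambda>t. f (x + t *\<^sub>R v)) t :> f' (x + t *\<^sub>R v) v"
      by (auto simp: has_field_derivative_def blinfun.scaleR_right mult.commute[of _ "_ :: real"]
        elim!: has_derivative_eq_rhs)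
  qed
  have "open ((\<lambda>t::real. x + t *\<^sub>R v) -` U)"
    using U by (intro continuous_open_vimage continuous_intros) auto
  then have "\<forall>\<^sub>F t in nhds 0. t \<in> (\<lambda>t::real. x + t *\<^sub>R v) -` U"
    using U by (intro eventually_nhds_in_open) auto
  then have "\<forall>\<^sub>F t in nhds 0. deriv (\<lambda>t. f (x + t *\<^sub>R v)) t = f' (x + t *\<^sub>R v) v"
    by eventually_elim (auto simp: d1)
  then have "deriv (deriv (\<lambda>t. f (x + t *\<^sub>R v))) 0 = deriv (\<lambda>t. f' (x + t *\<^sub>R v) v) 0"
    by (rule deriv_cong_ev) simp
  also have "\<dots> = f'' x v v"
  proof (rule DERIV_imp_deriv)
    have x0: "(f' has_derivative blinfun_apply (f'' x)) (at (x + 0 *\<^sub>R v))"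
      using f''[OF U(2)] by simp
    have "((\<lambda>t. f' (x + t *\<^sub>R v) v) has_derivative (\<lambda>s. f'' x (s *\<^sub>R v) v)) (at 0)"
      by (rule bounded_linear.has_derivative[OF blinfun.bounded_linear_left
            has_derivative_compose[OF line x0]])
    then show "DERIV (\<lambda>t. f' (x + t *\<^sub>R v) v) 0 :> f'' x v v"
      by (auto simp: has_field_derivative_def blinfun.scaleR_right blinfun.scaleR_left
        mult.commute[of _ "_ :: real"] elim!: has_derivative_eq_rhs)
  qed
  finally show ?thesis .
qed

lemma C2_on_real_derivs:
  fixes h :: "real \<Rightarrow> real"
  assumes "open U" "C2_on U h"
  obtains h' h'' where
    "\<And>x. x \<in> U \<Longrightarrow> (h has_derivative blinfun_apply (h' x)) (at x)"
    "\<And>x. x \<in> U \<Longrightarrow> (h' has_derivative blinfun_apply (h'' x)) (at x)"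
    "\<And>x. x \<in> U \<Longrightarrow> (h has_real_derivative deriv h x) (at x)"
    "\<And>x v. x \<in> U \<Longrightarrow> h'' x v v = deriv (deriv h) x * (norm v)\<^sup>2"
    "continuous_on U (deriv h)"
proof -
  obtain h' h'' where h': "\<And>x. x \<in> U \<Longrightarrow> (h has_derivative blinfun_apply (h' x)) (at x)"
    and h'': "\<And>x. x \<in> U \<Longrightarrow> (h' has_derivative blinfun_apply (h'' x)) (at x)"
    using assms(2) unfolding C2_on_def by blast
  have scale: "blinfun_apply B v = v *\<^sub>R blinfun_apply B 1" for B :: "real \<Rightarrow>\<^sub>L 'b::real_normed_vector" and v :: real
    using blinfun.scaleR_right[of B v 1] by simp
  have d1: "deriv h x = h' x 1" if "x \<in> U" for x
  proof (rule DERIV_imp_deriv)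
    show "DERIV h x :> h' x 1"
      using h'[OF that] unfolding has_field_derivative_def
      by (rule has_derivative_eq_rhs) (rule ext, subst scale, simp add: fun_eq_iff mult.commute)
  qed
  have ev: "\<forall>\<^sub>F t in nhds x. deriv h t = h' t 1" if "x \<in> U" for x
    using eventually_nhds_in_open[OF assms(1) that] by eventually_elim (auto simp: d1)
  have der: "((\<lambda>t. h' t 1) has_derivative (\<lambda>s. h'' x s 1)) (at x)" if "x \<in> U" for x
    by (rule bounded_linear.has_derivative[OF blinfun.bounded_linear_left h''[OF that]])
  have d2: "deriv (deriv h) x = h'' x 1 1" if "x \<in> U" for x
  proof -
    have "deriv (deriv h) x = deriv (\<lambda>t. h' t 1) x"
      using ev[OF that] by (rule deriv_cong_ev) simp
    also have "\<dots> = h'' x 1 1"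
    proof (rule DERIV_imp_deriv)
      show "DERIV (\<lambda>t. h' t 1) x :> h'' x 1 1"
        using der[OF that] unfolding has_field_derivative_def
        by (rule has_derivative_eq_rhs)
          (rule ext, subst scale, simp add: blinfun.scaleR_left mult.commute)
    qed
    finally show ?thesis .
  qed
  show thesis
  proof (rule that[OF h' h''])
    fix x v assume x: "x \<in> U"
    show "(h has_real_derivative deriv h x) (at x)"
      using h'[OF x] unfolding has_field_derivative_def
      by (rule has_derivative_eq_rhs) (rule ext, subst scale, simp add: d1[OF x])
    show "h'' x v v = deriv (deriv h) x * (norm v)\<^sup>2"
      by (subst scale[of "h'' x"], subst blinfun.scaleR_left, subst scale)
        (simp add: d2[OF x] power2_eq_square)
  next
    have "continuous_on U (\<lambda>t. h' t 1)"
      using der by (meson continuous_at_imp_continuous_on has_derivative_continuous)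
    then show "continuous_on U (deriv h)"
      using d1 by (simp cong: continuous_on_cong)
  qed
qed

lemma mean_value_segment:
  fixes h :: "real \<Rightarrow> real"
  assumes "\<And>t. t \<in> closed_segment a b \<Longrightarrow> (h has_real_derivative deriv h t) (at t)"
  obtains t where "t \<in> closed_segment a b" "h b - h a = (b - a) * deriv h t"
proof (cases a b rule: linorder_cases)
  case less
  then obtain t where "a < t" "t < b" "h b - h a = (b - a) * deriv h t"
    using MVT2[of a b h "deriv h"] assms by (auto simp: closed_segment_eq_real_ivl)
  then show thesis using that[of t] by (auto simp: closed_segment_eq_real_ivl)
next
  case greater
  then obtain t where "b < t" "t < a" "h a - h b = (a - b) * deriv h t"
    using MVT2[of b a h "deriv h"] assms by (auto simp: closed_segment_eq_real_ivl)
  then show thesis using that[of t] by (auto simp: closed_segment_eq_real_ivl algebra_simps)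
qed (use that[of a] in auto)

section \<open>Geometry of a simplex collection\<close>

text \<open>
  Used for the simplexes themselves and, with real numbers as the points, for the set of values of
  an interpolant on a simplex.
\<close>

lemma convex_barycentric_combinations:
  fixes p :: "nat \<Rightarrow> 'a::real_vector"
  shows "convex {\<Sum>j=1..n+1. w j *\<^sub>R p j | w. bary_weights n w}"
proof (rule convexI)
  fix x y and u v :: real
  assume "x \<in> {\<Sum>j=1..n+1. w j *\<^sub>R p j | w. bary_weights n w}"
    and "y \<in> {\<Sum>j=1..n+1. w j *\<^sub>R p j | w. bary_weights n w}"
    and uv: "0 \<le> u" "0 \<le> v" "u + v = 1"
  then obtain w w' where w: "bary_weights n w" "x = (\<Sum>j=1..n+1. w j *\<^sub>R p j)"
    and w': "bary_weights n w'" "y = (\<Sum>j=1..n+1. w' j *\<^sub>R p j)" by auto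
  have "bary_weights n (\<lambda>j. u * w j + v * w' j)"
    using w w' uv unfolding bary_weights_def by (simp add: sum.distrib flip: sum_distrib_left)
  moreover have "u *\<^sub>R x + v *\<^sub>R y = (\<Sum>j=1..n+1. (u * w j + v * w' j) *\<^sub>R p j)"
    unfolding w w' by (simp only: scaleR_sum_right scaleR_scaleR scaleR_add_left sum.distrib)
  ultimately show "u *\<^sub>R x + v *\<^sub>R y \<in> {\<Sum>j=1..n+1. w j *\<^sub>R p j | w. bary_weights n w}"
    by auto
qed

lemma bary_weights_vertex:
  assumes "j \<in> {1..n+1}"
  shows "bary_weights n (\<lambda>k. if k = j then 1 else 0)"
    and "(\<Sum>k=1..n+1. (if k = j then 1 else 0) *\<^sub>R (p k :: 'a::real_vector)) = p j"
proof -
  show "bary_weights n (\<lambda>k. if k = j then 1 else 0)"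
    using assms unfolding bary_weights_def by (simp add: sum.delta del: sum.cl_ivl_Suc)
  have "(\<Sum>k=1..n+1. (if k = j then 1 else 0) *\<^sub>R p k) = (\<Sum>k=1..n+1. if k = j then p k else 0)"
    by (intro sum.cong) auto
  then show "(\<Sum>k=1..n+1. (if k = j then 1 else 0) *\<^sub>R p k) = p j"
    using assms by (simp add: sum.delta del: sum.cl_ivl_Suc)
qed

lemma convex_simplex: "convex (simplex_of S i)"
  unfolding simplex_of_def pt_def by (rule convex_barycentric_combinations)

lemma vert_in_simplex:
  fixes S :: "(real^'n) simplices"
  assumes "j \<in> {1..CARD('n)+1}"
  shows "vert S i j \<in> simplex_of S i"
proof -
  have "vert S i j = pt S i (\<lambda>k. if k = j then 1 else 0)"
    unfolding pt_def by (rule bary_weights_vertex(2)[OF assms, symmetric])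
  then show ?thesis
    using bary_weights_vertex(1)[OF assms] by (auto simp: simplex_of_def)
qed

lemma pt_in_simplex:
  fixes S :: "(real^'n) simplices"
  shows "bary_weights CARD('n) w \<Longrightarrow> pt S i w \<in> simplex_of S i"
  by (auto simp: simplex_of_def)

locale sampling_domain =
  fixes X Xt :: "(real^'n) set"
  assumes compact_X: "compact X" and X_nonempty: "X \<noteq> {}"
    and open_Xt: "open Xt" and X_sub: "X \<subseteq> Xt"

locale simplicial_grid = sampling_domain X Xt for X Xt :: "(real^'n) set" +
  fixes S :: "(real^'n) simplices"
  assumes coll: "simplex_collection X Xt S"
begin

lemma finite_idx: "finite (idx S)"
  and vert_in_X: "i \<in> idx S \<Longrightarrow> j \<in> {1..CARD('n)+1} \<Longrightarrow> vert S i j \<in> X"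
  and X_eq: "X = (\<Union>i\<in>idx S. simplex_of S i)"
  using coll unfolding simplex_collection_def by blast+

lemma idx_nonempty: "idx S \<noteq> {}"
  using X_nonempty X_eq by blast

lemma simplex_subset: "i \<in> idx S \<Longrightarrow> simplex_of S i \<subseteq> X"
  using X_eq by blast

lemma pt_in_X: "i \<in> idx S \<Longrightarrow> bary_weights CARD('n) w \<Longrightarrow> pt S i w \<in> X"
  using simplex_subset pt_in_simplex by blast

lemma X_cases:
  assumes "x \<in> X"
  obtains i w where "i \<in> idx S" "bary_weights CARD('n) w" "x = pt S i w"
  using assms X_eq unfolding simplex_of_def by blast

lemma finite_vertex_pairs:
  "finite {f i j j' | i j j'. i \<in> idx S \<and> j \<in> {1..CARD('n)+1} \<and> j' \<in> {1..CARD('n)+1}}"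
proof -
  have "{f i j j' | i j j'. i \<in> idx S \<and> j \<in> {1..CARD('n)+1} \<and> j' \<in> {1..CARD('n)+1}}
      \<subseteq> (\<lambda>(i, j, j'). f i j j') ` (idx S \<times> {1..CARD('n)+1} \<times> {1..CARD('n)+1})"
    by force
  then show ?thesis
    by (rule finite_subset) (use finite_idx in auto)
qed

lemma edge_le_tau:
  assumes "i \<in> idx S" "j \<in> {1..CARD('n)+1}" "j' \<in> {1..CARD('n)+1}"
  shows "norm (vert S i j - vert S i j') \<le> tau S"
  unfolding tau_def using assms by (intro Max_ge finite_vertex_pairs) blast

lemma tau_pos: "0 < tau S"
proof -
  obtain i where i: "i \<in> idx S" using idx_nonempty by blast
  let ?e = "\<lambda>j. vert S i j - vert S i (CARD('n)+1)"
  have "independent (?e ` {1..CARD('n)})"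
    using coll i unfolding simplex_collection_def by blast
  moreover have one: "(1::nat) \<in> {1..CARD('n)}" by (simp add: Suc_leI)
  ultimately have "?e 1 \<noteq> 0" by (metis dependent_zero imageI)
  then have "0 < norm (?e 1)" by simp
  also have "\<dots> \<le> tau S" using one by (intro edge_le_tau[OF i]) auto
  finally show ?thesis .
qed

lemma edge_difference_le_gconst:
  assumes "i \<in> idx S" "j \<in> {1..CARD('n)+1}" "j' \<in> {1..CARD('n)+1}"
  shows "\<bar>\<xi> (vert S i j) - \<xi> (vert S i j')\<bar> \<le> tau S * gconst S \<xi>"
proof -
  have "\<bar>\<xi> (vert S i j) - \<xi> (vert S i j')\<bar> / tau S \<le> gconst S \<xi>"
    unfolding gconst_def using assms by (intro Max_ge finite_vertex_pairs) blast
  then show ?thesis using tau_pos by (simp add: field_simps)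
qed

lemma gconst_nonneg: "0 \<le> gconst S \<xi>"
proof -
  obtain i where "i \<in> idx S" using idx_nonempty by blast
  then have "0 \<le> tau S * gconst S \<xi>"
    using edge_difference_le_gconst[of i 1 1 \<xi>] by auto
  then show ?thesis using tau_pos by (simp add: zero_le_mult_iff)
qed

text \<open>
  Edges are segments inside \<open>X\<close>, which is why a Lipschitz bound along such segments controls \<open>g\<close> even
  though the points of \<open>X\<close> may lie in different components.
\<close>

lemma gconst_le:
  assumes "\<And>x y. closed_segment x y \<subseteq> X \<Longrightarrow> \<bar>\<xi> x - \<xi> y\<bar> \<le> L * norm (x - y)" "0 \<le> L"
  shows "gconst S \<xi> \<le> L"
  unfolding gconst_def
proof (intro Max.boundedI finite_vertex_pairs)
  show "{\<bar>\<xi> (vert S i j) - \<xi> (vert S i j')\<bar> / tau S | i j j'.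
      i \<in> idx S \<and> j \<in> {1..CARD('n)+1} \<and> j' \<in> {1..CARD('n)+1}} \<noteq> {}"
    using idx_nonempty by fastforce
  fix z assume "z \<in> {\<bar>\<xi> (vert S i j) - \<xi> (vert S i j')\<bar> / tau S | i j j'.
      i \<in> idx S \<and> j \<in> {1..CARD('n)+1} \<and> j' \<in> {1..CARD('n)+1}}"
  then obtain i j j' where ij: "i \<in> idx S" "j \<in> {1..CARD('n)+1}" "j' \<in> {1..CARD('n)+1}"
    and z: "z = \<bar>\<xi> (vert S i j) - \<xi> (vert S i j')\<bar> / tau S" by blast
  have "closed_segment (vert S i j) (vert S i j') \<subseteq> X"
    using closed_segment_subset[OF vert_in_simplex vert_in_simplex convex_simplex, of j j' S i]
      simplex_subset[OF ij(1)] ij by blast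
  then have "\<bar>\<xi> (vert S i j) - \<xi> (vert S i j')\<bar> \<le> L * norm (vert S i j - vert S i j')"
    by (rule assms(1))
  also have "\<dots> \<le> L * tau S"
    using edge_le_tau[OF ij] assms(2) by (intro mult_left_mono)
  finally show "z \<le> L" using tau_pos by (simp add: z field_simps)
qed

lemma finite_verts: "finite (verts S)"
proof -
  have "verts S = (\<lambda>(i, j). vert S i j) ` (idx S \<times> {1..CARD('n)+1})"
    unfolding verts_def by force
  then show ?thesis using finite_idx by simp
qed

lemma verts_nonempty: "verts S \<noteq> {}"
  using idx_nonempty unfolding verts_def by fastforce

lemma verts_sub: "verts S \<subseteq> X"
  using vert_in_X unfolding verts_def by blast

lemma interp_val_between:
  assumes "i \<in> idx S" "bary_weights CARD('n) w"
  shows "Min (\<xi> ` verts S) \<le> interp_val S \<xi> i w" "interp_val S \<xi> i w \<le> Max (\<xi> ` verts S)"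
proof -
  let ?J = "{1..CARD('n)+1}"
  have w: "\<And>j. j \<in> ?J \<Longrightarrow> 0 \<le> w j" "sum w ?J = 1"
    using assms(2) unfolding bary_weights_def by blast+
  have v: "Min (\<xi> ` verts S) \<le> \<xi> (vert S i j)" "\<xi> (vert S i j) \<le> Max (\<xi> ` verts S)"
    if "j \<in> ?J" for j
    using that assms(1) finite_verts by (auto simp: verts_def intro!: Min_le Max_ge)
  have "Min (\<xi> ` verts S) = (\<Sum>j\<in>?J. w j * Min (\<xi> ` verts S))"
    unfolding sum_distrib_right[symmetric] using w(2) by simp
  also have "\<dots> \<le> interp_val S \<xi> i w"
    unfolding interp_val_def by (intro sum_mono mult_left_mono v w)
  finally show "Min (\<xi> ` verts S) \<le> interp_val S \<xi> i w" .
  have "interp_val S \<xi> i w \<le> (\<Sum>j\<in>?J. w j * Max (\<xi> ` verts S))"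
    unfolding interp_val_def by (intro sum_mono mult_left_mono v w)
  also have "\<dots> = Max (\<xi> ` verts S)"
    unfolding sum_distrib_right[symmetric] using w(2) by simp
  finally show "interp_val S \<xi> i w \<le> Max (\<xi> ` verts S)" .
qed

lemma interp_pt:
  assumes "continuous_on Xt \<xi>" "i \<in> idx S" "bary_weights CARD('n) w"
  shows "interp S \<xi> (pt S i w) = interp_val S \<xi> i w"
  unfolding interp_def
proof (rule the_equality)
  show "\<exists>i'\<in>idx S. \<exists>w'. bary_weights CARD('n) w' \<and> pt S i w = pt S i' w'
      \<and> interp_val S \<xi> i w = interp_val S \<xi> i' w'"
    using assms by blast
  show "v = interp_val S \<xi> i w" if "\<exists>i'\<in>idx S. \<exists>w'. bary_weights CARD('n) w'
      \<and> pt S i w = pt S i' w' \<and> v = interp_val S \<xi> i' w'" for v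
    using that assms coll unfolding simplex_collection_def by metis
qed

lemma convex_image_simplex:
  fixes y :: "real^'n \<Rightarrow> real"
  assumes "continuous_on Xt y" "i \<in> idx S"
  shows "convex (y ` simplex_of S i)"
proof -
  have "continuous_on (simplex_of S i) y"
    using assms simplex_subset X_sub by (meson continuous_on_subset order_trans)
  then have "connected (y ` simplex_of S i)"
    by (intro connected_continuous_image convex_connected convex_simplex)
  then show ?thesis
    by (simp add: connected_convex_1)
qed

text \<open>
  Intermediate value theorem: an average of vertex values is itself a value on the simplex. Hence
  an outer function is defined at the interpolated inner value, although its domain is only
  assumed to contain the true inner values.
\<close>

lemma interp_val_in_image:
  fixes y :: "real^'n \<Rightarrow> real"
  assumes "continuous_on Xt y" "i \<in> idx S" "bary_weights CARD('n) w"
  shows "interp_val S y i w \<in> y ` simplex_of S i"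
proof -
  have "(\<Sum>j=1..CARD('n)+1. w j *\<^sub>R y (vert S i j)) \<in> y ` simplex_of S i"
    using assms(3) unfolding bary_weights_def
    by (intro convex_sum convex_image_simplex[OF assms(1,2)]) (auto intro!: vert_in_simplex imageI)
  then show ?thesis by (simp add: interp_val_def)
qed

lemma interp_image_subset:
  fixes y :: "real^'n \<Rightarrow> real"
  assumes "continuous_on Xt y"
  shows "interp S y ` X \<subseteq> y ` X"
proof
  fix t assume "t \<in> interp S y ` X"
  then obtain i w where "i \<in> idx S" "bary_weights CARD('n) w" "t = interp_val S y i w"
    using interp_pt[OF assms] by (auto elim!: X_cases)
  then show "t \<in> y ` X"
    using interp_val_in_image[OF assms] simplex_subset by blast
qed

end

section \<open>Orders of magnitude\<close>

context sampling_domain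
begin

lemma grid: "simplex_collection X Xt S \<Longrightarrow> simplicial_grid X Xt S"
  using sampling_domain_axioms by (simp add: simplicial_grid_def simplicial_grid_axioms_def)

text \<open>
  Order 0 means bounded for small \<open>tau\<close>. With this reading the rules for sums, products and maxima
  turn the claim on the order of the margins into a syntax-directed check.
\<close>

lemma is_OprimeI:
  assumes "0 < t" "0 < C"
    and "\<And>S. simplex_collection X Xt S \<Longrightarrow> tau S \<le> t \<Longrightarrow> \<bar>m S\<bar> \<le> C * tau S ^ p"
  shows "is_Oprime X Xt p m"
  using assms unfolding is_Oprime_def by blast

lemma is_OprimeE:
  assumes "is_Oprime X Xt p m"
  obtains t C where "0 < t" "0 < C"
    "\<And>S. simplex_collection X Xt S \<Longrightarrow> tau S \<le> t \<Longrightarrow> \<bar>m S\<bar> \<le> C * tau S ^ p"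
  using assms unfolding is_Oprime_def by blast

lemma is_Oprime_mono:
  assumes "is_Oprime X Xt p m'"
    and "\<And>S. simplex_collection X Xt S \<Longrightarrow> \<bar>m S\<bar> \<le> \<bar>m' S\<bar>"
  shows "is_Oprime X Xt p m"
  using assms unfolding is_Oprime_def by (meson order_trans)

lemma is_Oprime_bounded:
  assumes "\<And>S. simplex_collection X Xt S \<Longrightarrow> \<bar>m S\<bar> \<le> B"
  shows "is_Oprime X Xt 0 m"
proof (rule is_OprimeI[of 1 "max B 1"])
  show "\<bar>m S\<bar> \<le> max B 1 * tau S ^ 0" if "simplex_collection X Xt S" "tau S \<le> 1" for S
    using assms[of S] that by simp
qed auto

lemma tau_nonneg: "simplex_collection X Xt S \<Longrightarrow> 0 \<le> tau S"
  using simplicial_grid.tau_pos[OF grid] by (rule less_imp_le)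

lemma is_Oprime_tau_power: "is_Oprime X Xt p (\<lambda>S. tau S ^ p)"
  by (rule is_OprimeI[of 1 1]) (auto dest: tau_nonneg)

lemma is_Oprime_add:
  assumes "is_Oprime X Xt p a" "is_Oprime X Xt p b"
  shows "is_Oprime X Xt p (\<lambda>S. a S + b S)"
proof -
  obtain t C where a: "0 < t" "0 < C"
    "\<And>S. simplex_collection X Xt S \<Longrightarrow> tau S \<le> t \<Longrightarrow> \<bar>a S\<bar> \<le> C * tau S ^ p"
    using assms(1) by (rule is_OprimeE) blast
  obtain t' C' where b: "0 < t'" "0 < C'"
    "\<And>S. simplex_collection X Xt S \<Longrightarrow> tau S \<le> t' \<Longrightarrow> \<bar>b S\<bar> \<le> C' * tau S ^ p"
    using assms(2) by (rule is_OprimeE) blast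
  show ?thesis
  proof (rule is_OprimeI[of "min t t'" "C + C'"])
    show "\<bar>a S + b S\<bar> \<le> (C + C') * tau S ^ p"
      if "simplex_collection X Xt S" "tau S \<le> min t t'" for S
      using a(3)[of S] b(3)[of S] that by (simp add: distrib_right)
  qed (use a b in auto)
qed

lemma is_Oprime_mult:
  assumes "is_Oprime X Xt p a" "is_Oprime X Xt q b"
  shows "is_Oprime X Xt (p + q) (\<lambda>S. a S * b S)"
proof -
  obtain t C where a: "0 < t" "0 < C"
    "\<And>S. simplex_collection X Xt S \<Longrightarrow> tau S \<le> t \<Longrightarrow> \<bar>a S\<bar> \<le> C * tau S ^ p"
    using assms(1) by (rule is_OprimeE) blast
  obtain t' C' where b: "0 < t'" "0 < C'"
    "\<And>S. simplex_collection X Xt S \<Longrightarrow> tau S \<le> t' \<Longrightarrow> \<bar>b S\<bar> \<le> C' * tau S ^ q"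
    using assms(2) by (rule is_OprimeE) blast
  show ?thesis
  proof (rule is_OprimeI[of "min t t'" "C * C'"])
    show "\<bar>a S * b S\<bar> \<le> C * C' * tau S ^ (p + q)"
      if S: "simplex_collection X Xt S" "tau S \<le> min t t'" for S
    proof -
      have "\<bar>a S\<bar> * \<bar>b S\<bar> \<le> (C * tau S ^ p) * (C' * tau S ^ q)"
        using a b S tau_nonneg[of S] by (intro mult_mono) auto
      then show ?thesis by (simp add: abs_mult power_add mult_ac)
    qed
  qed (use a b in auto)
qed

lemma is_Oprime_const: "is_Oprime X Xt 0 (\<lambda>S. k)"
  by (rule is_Oprime_bounded[of _ "\<bar>k\<bar>"]) simp

lemma is_Oprime_zero: "is_Oprime X Xt p (\<lambda>S. 0)"
  using is_Oprime_mono[OF is_Oprime_tau_power] by simp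

lemma is_Oprime_sum:
  assumes "\<And>s. s \<in> A \<Longrightarrow> is_Oprime X Xt p (f s)"
  shows "is_Oprime X Xt p (\<lambda>S. \<Sum>s\<in>A. f s S)"
  using assms
  by (induction A rule: infinite_finite_induct) (auto simp: is_Oprime_zero intro: is_Oprime_add)

lemma is_Oprime_uminus: "is_Oprime X Xt p a \<Longrightarrow> is_Oprime X Xt p (\<lambda>S. - a S)"
  by (erule is_Oprime_mono) simp

lemma is_Oprime_max:
  assumes "is_Oprime X Xt p a" "is_Oprime X Xt p b"
  shows "is_Oprime X Xt p (\<lambda>S. max (a S) (b S))"
proof (rule is_Oprime_mono)
  show "is_Oprime X Xt p (\<lambda>S. \<bar>a S\<bar> + \<bar>b S\<bar>)"
    by (intro is_Oprime_add; rule is_Oprime_mono[OF assms(1)] is_Oprime_mono[OF assms(2)]) simp_all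
qed auto

lemma is_Oprime_weaken:
  assumes "is_Oprime X Xt p a" shows "is_Oprime X Xt 0 a"
proof -
  obtain t C where a: "0 < t" "0 < C"
    "\<And>S. simplex_collection X Xt S \<Longrightarrow> tau S \<le> t \<Longrightarrow> \<bar>a S\<bar> \<le> C * tau S ^ p"
    using assms(1) by (rule is_OprimeE) blast
  show ?thesis
  proof (rule is_OprimeI[of "min t 1" C])
    show "\<bar>a S\<bar> \<le> C * tau S ^ 0" if "simplex_collection X Xt S" "tau S \<le> min t 1" for S
    proof -
      have "\<bar>a S\<bar> \<le> C * tau S ^ p" using a that by simp
      also have "\<dots> \<le> C * 1" using a that tau_nonneg[of S] by (intro mult_left_mono power_le_one) auto
      finally show ?thesis by simp
    qed
  qed (use a in auto)
qed

lemma is_Oprime_mult_bounded: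
  assumes "is_Oprime X Xt p a" "is_Oprime X Xt 0 b"
  shows "is_Oprime X Xt p (\<lambda>S. a S * b S)" "is_Oprime X Xt p (\<lambda>S. b S * a S)"
  using is_Oprime_mult[OF assms] is_Oprime_mult[OF assms(2,1)] by simp_all

section \<open>Regularity of the functions in the classes\<close>

text \<open>
  The regularity that keeps the constants \<open>b\<close> and \<open>g\<close> bounded uniformly in the simplex collection:
  continuity bounds the values on the compact set \<open>X\<close>, and the Lipschitz bound along segments in \<open>X\<close>
  bounds the difference quotients along edges. Unlike differentiability it also survives
  composition with a convex Lipschitz outer function.
\<close>

definition tame :: "(real^'n \<Rightarrow> real) \<Rightarrow> bool" where
  "tame \<xi> \<longleftrightarrow> continuous_on Xt \<xi> \<and>
     (\<exists>L\<ge>0. \<forall>x y. closed_segment x y \<subseteq> X \<longrightarrow> \<bar>\<xi> x - \<xi> y\<bar> \<le> L * norm (x - y))"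

lemma tameE:
  assumes "tame \<xi>"
  obtains L where "continuous_on Xt \<xi>" "0 \<le> L"
    "\<And>x y. closed_segment x y \<subseteq> X \<Longrightarrow> \<bar>\<xi> x - \<xi> y\<bar> \<le> L * norm (x - y)"
  using assms unfolding tame_def by blast

lemma tame_continuous: "tame \<xi> \<Longrightarrow> continuous_on Xt \<xi>"
  unfolding tame_def by simp

lemma tame_bounded:
  assumes "tame \<xi>"
  obtains B where "\<And>x. x \<in> X \<Longrightarrow> \<bar>\<xi> x\<bar> \<le> B"
proof -
  have "compact (\<xi> ` X)"
    using tame_continuous[OF assms] X_sub compact_X
    by (meson compact_continuous_image continuous_on_subset)
  then have "bounded (\<xi> ` X)" by (rule compact_imp_bounded)
  then obtain B where "\<forall>t\<in>\<xi> ` X. norm t \<le> B" unfolding bounded_iff by blast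
  then show thesis using that[of B] by simp
qed

lemma tame_cong:
  assumes "tame \<xi>" "\<And>x. x \<in> Xt \<Longrightarrow> \<xi>' x = \<xi> x"
  shows "tame \<xi>'"
proof -
  obtain L where L: "continuous_on Xt \<xi>" "0 \<le> L"
    "\<And>x y. closed_segment x y \<subseteq> X \<Longrightarrow> \<bar>\<xi> x - \<xi> y\<bar> \<le> L * norm (x - y)"
    using assms(1) by (rule tameE) blast
  have "\<bar>\<xi>' x - \<xi>' y\<bar> \<le> L * norm (x - y)" if seg: "closed_segment x y \<subseteq> X" for x y
  proof -
    have "x \<in> Xt" "y \<in> Xt" using seg X_sub by auto
    then show ?thesis using L(3)[OF seg] assms(2) by simp
  qed
  moreover have "continuous_on Xt \<xi>'"
    using L(1) assms(2) by (simp cong: continuous_on_cong)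
  ultimately show ?thesis using L(2) unfolding tame_def by blast
qed

lemma tame_C2:
  assumes "C2_on Xt \<xi>" shows "tame \<xi>"
proof -
  obtain f' f'' where f': "\<And>x. x \<in> Xt \<Longrightarrow> (\<xi> has_derivative blinfun_apply (f' x)) (at x)"
    and f'': "\<And>x. x \<in> Xt \<Longrightarrow> (f' has_derivative blinfun_apply (f'' x)) (at x)"
    using assms unfolding C2_on_def by blast
  have "continuous_on X f'"
    using f'' X_sub by (meson continuous_at_imp_continuous_on has_derivative_continuous subsetD)
  then have "bounded (f' ` X)"
    using compact_X by (intro compact_imp_bounded compact_continuous_image)
  then obtain L where L: "0 < L" "\<And>x. x \<in> X \<Longrightarrow> norm (f' x) \<le> L"
    unfolding bounded_pos by auto
  have "\<bar>\<xi> x - \<xi> y\<bar> \<le> L * norm (x - y)" if seg: "closed_segment x y \<subseteq> X" for x y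
  proof -
    have "norm (\<xi> x - \<xi> y) \<le> L * norm (x - y)"
    proof (rule differentiable_bound[of "closed_segment x y" \<xi> "\<lambda>x. blinfun_apply (f' x)"])
      show "(\<xi> has_derivative blinfun_apply (f' z)) (at z within closed_segment x y)"
        if "z \<in> closed_segment x y" for z
        using f'[of z] that seg X_sub by (blast intro: has_derivative_at_withinI)
      show "onorm (blinfun_apply (f' z)) \<le> L" if "z \<in> closed_segment x y" for z
        using L(2)[of z] that seg by (auto simp: norm_blinfun.rep_eq)
    qed auto
    then show ?thesis by simp
  qed
  moreover have "continuous_on Xt \<xi>"
    using f' by (meson continuous_at_imp_continuous_on has_derivative_continuous)
  ultimately show ?thesis using L(1) unfolding tame_def by (meson less_imp_le)
qed

lemma tame_zero: "tame (\<lambda>x. 0)"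
  unfolding tame_def by (auto intro: exI[of _ 0])

lemma tame_add:
  assumes "tame \<xi>" "tame \<eta>" shows "tame (\<lambda>x. \<xi> x + \<eta> x)"
proof -
  obtain L where L: "continuous_on Xt \<xi>" "0 \<le> L"
    "\<And>x y. closed_segment x y \<subseteq> X \<Longrightarrow> \<bar>\<xi> x - \<xi> y\<bar> \<le> L * norm (x - y)"
    using assms(1) by (rule tameE) blast
  obtain M where M: "continuous_on Xt \<eta>" "0 \<le> M"
    "\<And>x y. closed_segment x y \<subseteq> X \<Longrightarrow> \<bar>\<eta> x - \<eta> y\<bar> \<le> M * norm (x - y)"
    using assms(2) by (rule tameE) blast
  have "\<bar>(\<xi> x + \<eta> x) - (\<xi> y + \<eta> y)\<bar> \<le> (L + M) * norm (x - y)" if "closed_segment x y \<subseteq> X" for x y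
    using L(3)[OF that] M(3)[OF that] by (simp add: distrib_right)
  then show ?thesis
    unfolding tame_def using L(1,2) M(1,2) by (auto intro!: continuous_intros exI[of _ "L + M"])
qed

lemma tame_mult:
  assumes "tame \<xi>" "tame \<eta>" shows "tame (\<lambda>x. \<xi> x * \<eta> x)"
proof -
  obtain L where L: "continuous_on Xt \<xi>" "0 \<le> L"
    "\<And>x y. closed_segment x y \<subseteq> X \<Longrightarrow> \<bar>\<xi> x - \<xi> y\<bar> \<le> L * norm (x - y)"
    using assms(1) by (rule tameE) blast
  obtain M where M: "continuous_on Xt \<eta>" "0 \<le> M"
    "\<And>x y. closed_segment x y \<subseteq> X \<Longrightarrow> \<bar>\<eta> x - \<eta> y\<bar> \<le> M * norm (x - y)"
    using assms(2) by (rule tameE) blast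
  obtain B where B: "\<And>x. x \<in> X \<Longrightarrow> \<bar>\<xi> x\<bar> \<le> B" using tame_bounded[OF assms(1)] by blast
  obtain B' where B': "\<And>x. x \<in> X \<Longrightarrow> \<bar>\<eta> x\<bar> \<le> B'" using tame_bounded[OF assms(2)] by blast
  have nonneg: "0 \<le> B" "0 \<le> B'"
    using B B' X_nonempty by (meson abs_ge_zero all_not_in_conv order_trans)+
  have "\<bar>\<xi> x * \<eta> x - \<xi> y * \<eta> y\<bar> \<le> (B * M + B' * L) * norm (x - y)"
    if seg: "closed_segment x y \<subseteq> X" for x y
  proof -
    have xy: "x \<in> X" "y \<in> X" using seg by auto
    have "\<bar>\<xi> x * \<eta> x - \<xi> y * \<eta> y\<bar> = \<bar>\<xi> x * (\<eta> x - \<eta> y) + \<eta> y * (\<xi> x - \<xi> y)\<bar>"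
      by (simp add: algebra_simps)
    also have "\<dots> \<le> \<bar>\<xi> x\<bar> * \<bar>\<eta> x - \<eta> y\<bar> + \<bar>\<eta> y\<bar> * \<bar>\<xi> x - \<xi> y\<bar>"
      by (rule order_trans[OF abs_triangle_ineq]) (simp add: abs_mult)
    also have "\<dots> \<le> B * (M * norm (x - y)) + B' * (L * norm (x - y))"
      using B[OF xy(1)] B'[OF xy(2)] L(3)[OF seg] M(3)[OF seg] nonneg
      by (intro add_mono mult_mono) auto
    finally show ?thesis by (simp add: algebra_simps)
  qed
  then show ?thesis
    unfolding tame_def using L(1,2) M(1,2) nonneg
    by (auto intro!: continuous_intros exI[of _ "B * M + B' * L"])
qed

lemma tame_inner_sum:
  assumes "\<And>s. s \<in> {1..T} \<Longrightarrow> tame (phi D s)" "\<And>s. s \<in> {1..T} \<Longrightarrow> tame (psi D s)"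
  shows "tame (inner_sum T D)"
proof -
  have "tame (\<lambda>x. \<Sum>s\<in>A. phi D s x * psi D s x)" if "A \<subseteq> {1..T}" for A
    using finite_subset[OF that finite_atLeastAtMost] that
    by (induction A) (auto simp: tame_zero intro!: tame_add tame_mult assms)
  then show ?thesis unfolding inner_sum_def[abs_def] by blast
qed

text \<open>
  The image of a segment is an interval inside the compact set of inner values, so an outer
  function needs bounded slope only on that compact set.
\<close>

lemma tame_comp_C2:
  assumes y: "tame y" and U: "open U" "y ` Xt \<subseteq> U" and h: "C2_on U h"
  shows "tame (\<lambda>x. h (y x))"
proof -
  obtain L where L: "continuous_on Xt y" "0 \<le> L"
    "\<And>x z. closed_segment x z \<subseteq> X \<Longrightarrow> \<bar>y x - y z\<bar> \<le> L * norm (x - z)"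
    using y by (rule tameE) blast
  have der: "\<And>t. t \<in> U \<Longrightarrow> (h has_real_derivative deriv h t) (at t)"
    and cont: "continuous_on U (deriv h)"
    using C2_on_real_derivs[OF U(1) h] by metis+
  have yX: "compact (y ` X)" "y ` X \<subseteq> U"
    using L(1) X_sub compact_X U(2) by (auto intro!: compact_continuous_image continuous_on_subset[OF L(1)])
  have "bounded (deriv h ` y ` X)"
    by (rule compact_imp_bounded[OF compact_continuous_image[OF continuous_on_subset[OF cont yX(2)] yX(1)]])
  then obtain M where M: "0 < M" "\<And>t. t \<in> y ` X \<Longrightarrow> \<bar>deriv h t\<bar> \<le> M"
    unfolding bounded_pos by auto
  have "\<bar>h (y x) - h (y z)\<bar> \<le> M * L * norm (x - z)" if seg: "closed_segment x z \<subseteq> X" for x z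
  proof -
    have "continuous_on (closed_segment x z) y"
      using L(1) seg X_sub by (meson continuous_on_subset order_trans)
    then have "connected (y ` closed_segment x z)"
      by (intro connected_continuous_image convex_connected convex_closed_segment)
    then have "closed_segment (y z) (y x) \<subseteq> y ` closed_segment x z"
      by (intro closed_segment_subset) (auto simp: connected_convex_1)
    then have sub: "closed_segment (y z) (y x) \<subseteq> y ` X" using seg by blast
    obtain t where t: "t \<in> closed_segment (y z) (y x)" "h (y x) - h (y z) = (y x - y z) * deriv h t"
      using mean_value_segment[of "y z" "y x" h] der sub yX by blast
    have "\<bar>h (y x) - h (y z)\<bar> = \<bar>deriv h t\<bar> * \<bar>y x - y z\<bar>"
      unfolding t(2) by (simp add: abs_mult)
    also have "\<dots> \<le> M * (L * norm (x - z))"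
      using M t sub L(3)[OF seg] by (intro mult_mono) auto
    finally show ?thesis by (simp add: mult_ac)
  qed
  moreover have "continuous_on Xt (\<lambda>x. h (y x))"
  proof (rule continuous_on_compose2[OF _ L(1) U(2)])
    show "continuous_on U h"
      using der by (meson DERIV_continuous continuous_at_imp_continuous_on)
  qed
  ultimately show ?thesis
    unfolding tame_def using M(1) L(2) by (auto intro!: exI[of _ "M * L"])
qed

lemma tame_comp_lipschitz:
  assumes y: "tame y" and U: "y ` Xt \<subseteq> U" and h: "M-lipschitz_on U h"
  shows "tame (\<lambda>x. h (y x))"
proof -
  obtain L where L: "continuous_on Xt y" "0 \<le> L"
    "\<And>x z. closed_segment x z \<subseteq> X \<Longrightarrow> \<bar>y x - y z\<bar> \<le> L * norm (x - z)"
    using y by (rule tameE) blast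
  have M: "0 \<le> M" using h by (rule lipschitz_on_nonneg)
  have "\<bar>h (y x) - h (y z)\<bar> \<le> M * L * norm (x - z)" if seg: "closed_segment x z \<subseteq> X" for x z
  proof -
    have "y x \<in> U" "y z \<in> U" using seg X_sub U by auto
    then have "\<bar>h (y x) - h (y z)\<bar> \<le> M * \<bar>y x - y z\<bar>"
      using lipschitz_onD[OF h] by (simp add: dist_real_def)
    also have "\<dots> \<le> M * (L * norm (x - z))"
      using M L(3)[OF seg] by (intro mult_left_mono)
    finally show ?thesis by (simp add: mult_ac)
  qed
  moreover have "continuous_on Xt (\<lambda>x. h (y x))"
    by (rule continuous_on_compose2[OF lipschitz_on_continuous_on[OF h] L(1) U])
  ultimately show ?thesis
    unfolding tame_def using M L(2) by (auto intro!: exI[of _ "M * L"])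
qed

lemma gconst_bounded:
  assumes "tame \<xi>" shows "is_Oprime X Xt 0 (\<lambda>S. gconst S \<xi>)"
proof -
  obtain L where L: "0 \<le> L" "\<And>x y. closed_segment x y \<subseteq> X \<Longrightarrow> \<bar>\<xi> x - \<xi> y\<bar> \<le> L * norm (x - y)"
    using assms by (rule tameE) blast
  show ?thesis
  proof (rule is_Oprime_bounded)
    fix S assume "simplex_collection X Xt S"
    then interpret simplicial_grid X Xt S by (rule grid)
    show "\<bar>gconst S \<xi>\<bar> \<le> L" using gconst_nonneg gconst_le[OF L(2,1)] by simp
  qed
qed

lemma vertex_extrema_bounded:
  assumes "tame \<xi>"
  shows "is_Oprime X Xt 0 (\<lambda>S. Max (\<xi> ` verts S))" "is_Oprime X Xt 0 (\<lambda>S. Min (\<xi> ` verts S))"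
proof -
  obtain B where B: "\<And>x. x \<in> X \<Longrightarrow> \<bar>\<xi> x\<bar> \<le> B" using tame_bounded[OF assms] by blast
  have "\<bar>Max (\<xi> ` verts S)\<bar> \<le> B" "\<bar>Min (\<xi> ` verts S)\<bar> \<le> B" if "simplex_collection X Xt S" for S
  proof -
    interpret simplicial_grid X Xt S using that by (rule grid)
    have "Max (\<xi> ` verts S) \<in> \<xi> ` verts S" "Min (\<xi> ` verts S) \<in> \<xi> ` verts S"
      using finite_verts verts_nonempty by (auto intro!: Max_in Min_in)
    then show "\<bar>Max (\<xi> ` verts S)\<bar> \<le> B" "\<bar>Min (\<xi> ` verts S)\<bar> \<le> B"
      using B verts_sub by auto
  qed
  then show "is_Oprime X Xt 0 (\<lambda>S. Max (\<xi> ` verts S))" "is_Oprime X Xt 0 (\<lambda>S. Min (\<xi> ` verts S))"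
    by (auto intro: is_Oprime_bounded)
qed

end

section \<open>Interpolation gaps\<close>

definition gap :: "(real^'n) simplices \<Rightarrow> (real^'n \<Rightarrow> real) \<Rightarrow> nat \<Rightarrow> (nat \<Rightarrow> real) \<Rightarrow> real" where
  "gap S \<xi> i w = \<xi> (pt S i w) - interp_val S \<xi> i w"

text \<open>
  The formulas for \<open>a_hi\<close> and \<open>a_lo\<close>: a product with an error in \<open>[- m, M]\<close> and a factor in \<open>[l, u]\<close> is
  extreme at \<open>M u\<close> or \<open>- m l\<close>, depending on the sign of the factor. With a derivative as the factor the
  same lemma gives the first-order part of the margins of a composition.
\<close>

lemma mult_between:
  fixes e b :: real
  assumes "- m \<le> e" "e \<le> M" "0 \<le> m" "0 \<le> M" "l \<le> b" "b \<le> u"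
  shows "e * b \<le> max (M * u) (- m * l)" "- max (m * u) (- M * l) \<le> e * b"
proof -
  have *: "e * b \<le> max (M * u) (- m * l)" if "- m \<le> e" "e \<le> M" "0 \<le> m" "0 \<le> M" for e m M
  proof (cases "0 \<le> b")
    case True
    then have "e * b \<le> M * b" using that by (intro mult_right_mono)
    also have "\<dots> \<le> M * u" using that assms by (intro mult_left_mono)
    finally show ?thesis by simp
  next
    case False
    then have "e * b \<le> - m * b" using that by (intro mult_right_mono_neg) auto
    also have "\<dots> \<le> - m * l" using that assms by (intro mult_left_mono_neg) auto
    finally show ?thesis by simp
  qed
  show "e * b \<le> max (M * u) (- m * l)" using assms by (intro *)
  show "- max (m * u) (- M * l) \<le> e * b" using *[of M "- e" m] assms by simp
qed

lemma max_mult_nonneg: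
  fixes m M l u :: real
  assumes "0 \<le> m" "0 \<le> M" "l \<le> u"
  shows "0 \<le> max (M * u) (- m * l)"
proof (cases "0 \<le> u")
  case False
  then have "0 \<le> - m * l" using assms by (simp add: mult_nonneg_nonpos)
  then show ?thesis by simp
qed (use assms in \<open>simp add: le_max_iff_disj\<close>)

context simplicial_grid
begin

lemma weights_nonneg_sum:
  assumes "bary_weights CARD('n) w"
  shows "\<And>j. j \<in> {1..CARD('n)+1} \<Longrightarrow> 0 \<le> w j" "sum w {1..CARD('n)+1} = 1"
  using assms unfolding bary_weights_def by blast+

lemma gap_C2:
  assumes \<xi>: "C2_on Xt \<xi>" and i: "i \<in> idx S" and w: "bary_weights CARD('n) w"
    and d2: "\<And>x \<nu>. x \<in> X \<Longrightarrow> norm \<nu> = 1 \<Longrightarrow>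
      lo \<le> deriv (deriv (\<lambda>t. \<xi> (x + t *\<^sub>R \<nu>))) 0 \<and> deriv (deriv (\<lambda>t. \<xi> (x + t *\<^sub>R \<nu>))) 0 \<le> hi"
  shows "gap S \<xi> i w \<le> real CARD('n) * (tau S)\<^sup>2 / 8 * max 0 (- lo)"
    and "- (real CARD('n) * (tau S)\<^sup>2 / 8 * max 0 hi) \<le> gap S \<xi> i w"
proof -
  obtain f' f'' where f': "\<And>x. x \<in> Xt \<Longrightarrow> (\<xi> has_derivative blinfun_apply (f' x)) (at x)"
    and f'': "\<And>x. x \<in> Xt \<Longrightarrow> (f' has_derivative blinfun_apply (f'' x)) (at x)"
    using \<xi> unfolding C2_on_def by blast
  have quad: "lo * (norm v)\<^sup>2 \<le> f'' x v v \<and> f'' x v v \<le> hi * (norm v)\<^sup>2"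
    if x: "x \<in> simplex_of S i" for x v
  proof (cases "v = 0")
    case False
    define \<nu> where "\<nu> = v /\<^sub>R norm v"
    have v: "v = norm v *\<^sub>R \<nu>" and \<nu>: "norm \<nu> = 1" using False by (auto simp: \<nu>_def)
    have xX: "x \<in> X" using x simplex_subset[OF i] by blast
    have "f'' x (c *\<^sub>R \<nu>) (c *\<^sub>R \<nu>) = f'' x \<nu> \<nu> * c\<^sup>2" for c
      by (simp add: blinfun.scaleR_left blinfun.scaleR_right power2_eq_square)
    from this[of "norm v"] have "f'' x v v = f'' x \<nu> \<nu> * (norm v)\<^sup>2"
      by (simp only: v[symmetric])
    moreover have "lo \<le> f'' x \<nu> \<nu> \<and> f'' x \<nu> \<nu> \<le> hi"
      using d2[OF xX \<nu>] second_directional_derivative[OF open_Xt _ f' f'', of x \<nu>] xX X_sub by auto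
    ultimately show ?thesis by (simp add: mult_right_mono)
  qed (simp add: blinfun.zero_right)
  note prems = f' f'' convex_simplex[of S i] order_trans[OF simplex_subset[OF i] X_sub] vert_in_simplex
  note prems' = _ _ _ weights_nonneg_sum[OF w] edge_le_tau[OF i]
  have "\<xi> (pt S i w) - interp_val S \<xi> i w \<le> real CARD('n) * (tau S)\<^sup>2 / 8 * max 0 (- lo)"
    unfolding pt_def interp_val_def
    by (rule concave_gap_le[OF prems _ prems']) (use quad in \<open>auto simp: Suc_leI\<close>)
  then show "gap S \<xi> i w \<le> real CARD('n) * (tau S)\<^sup>2 / 8 * max 0 (- lo)"
    by (simp add: gap_def)
  have "interp_val S \<xi> i w - \<xi> (pt S i w) \<le> real CARD('n) * (tau S)\<^sup>2 / 8 * max 0 hi"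
    unfolding pt_def interp_val_def
    by (rule convex_gap_le[OF prems _ prems']) (use quad in \<open>auto simp: Suc_leI\<close>)
  then show "- (real CARD('n) * (tau S)\<^sup>2 / 8 * max 0 hi) \<le> gap S \<xi> i w"
    by (simp add: gap_def)
qed

text \<open>
  Writing \<open>\<phi>\<^sup>I\<close> for the interpolant, \<open>\<phi>\<psi> - (\<phi>\<psi>)\<^sup>I\<close> equals \<open>(\<phi> - \<phi>\<^sup>I) \<psi> + (\<psi> - \<psi>\<^sup>I) \<phi>\<^sup>I\<close> minus the covariance of the
  vertex values, because \<open>(\<phi>\<psi>)\<^sup>I - \<phi>\<^sup>I \<psi>\<^sup>I\<close> is that covariance.
\<close>

lemma gap_product:
  assumes i: "i \<in> idx S" and w: "bary_weights CARD('n) w"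
  shows "\<bar>gap S (\<lambda>x. \<phi> x * \<psi> x) i w
      - (gap S \<phi> i w * \<psi> (pt S i w) + gap S \<psi> i w * interp_val S \<phi> i w)\<bar>
    \<le> (tau S)\<^sup>2 * gconst S \<phi> * gconst S \<psi>"
proof -
  let ?J = "{1..CARD('n)+1}"
  let ?p = "\<lambda>j. \<phi> (vert S i j)" and ?q = "\<lambda>j. \<psi> (vert S i j)"
  define cov where "cov = (\<Sum>j\<in>?J. w j * ((?p j - (\<Sum>k\<in>?J. w k *\<^sub>R ?p k)) \<bullet> (?q j - (\<Sum>k\<in>?J. w k *\<^sub>R ?q k))))"
  have "cov = (\<Sum>j\<in>?J. w j * (?p j \<bullet> ?q j)) - (\<Sum>k\<in>?J. w k *\<^sub>R ?p k) \<bullet> (\<Sum>k\<in>?J. w k *\<^sub>R ?q k)"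
    unfolding cov_def by (rule weighted_covariance(1)[OF weights_nonneg_sum(2)[OF w]])
  then have cov: "cov = interp_val S (\<lambda>x. \<phi> x * \<psi> x) i w - interp_val S \<phi> i w * interp_val S \<psi> i w"
    by (simp add: interp_val_def)
  let ?b = "tau S * gconst S \<phi> * (tau S * gconst S \<psi>)"
  have b: "0 \<le> ?b" using tau_pos gconst_nonneg by simp
  have "\<bar>cov\<bar> \<le> ?b / 2 * (1 - (\<Sum>j\<in>?J. (w j)\<^sup>2))"
    unfolding cov_def
    by (rule weighted_covariance_le[OF _ weights_nonneg_sum[OF w]])
      (use edge_difference_le_gconst[OF i] in \<open>auto simp del: sum.cl_ivl_Suc\<close>)
  also have "\<dots> \<le> ?b / 2 * 1"
  proof (rule mult_left_mono)
    show "1 - (\<Sum>j\<in>?J. (w j)\<^sup>2) \<le> 1" by (simp add: sum_nonneg del: sum.cl_ivl_Suc)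
  qed (use b in linarith)
  also have "\<dots> \<le> ?b" using b by linarith
  finally have "\<bar>cov\<bar> \<le> (tau S)\<^sup>2 * gconst S \<phi> * gconst S \<psi>"
    by (simp add: power2_eq_square mult_ac)
  moreover have "gap S (\<lambda>x. \<phi> x * \<psi> x) i w
      - (gap S \<phi> i w * \<psi> (pt S i w) + gap S \<psi> i w * interp_val S \<phi> i w) = - cov"
    unfolding cov gap_def by (simp add: algebra_simps)
  ultimately show ?thesis by simp
qed

lemma gap_inner_sum:
  "gap S (inner_sum T D) i w = (\<Sum>s=1..T. gap S (\<lambda>x. phi D s x * psi D s x) i w)"
proof -
  have "interp_val S (inner_sum T D) i w = (\<Sum>s=1..T. interp_val S (\<lambda>x. phi D s x * psi D s x) i w)"
    unfolding interp_val_def inner_sum_def sum_distrib_left by (rule sum.swap)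
  then show ?thesis
    unfolding gap_def by (simp add: inner_sum_def sum_subtractf)
qed

text \<open>
  Both end points lie in the image of one simplex, which is an interval. Bounds on the derivative
  of an outer function that hold at the true inner values therefore apply in the mean value theorem.
\<close>

lemma segment_in_image:
  fixes y :: "real^'n \<Rightarrow> real"
  assumes y: "continuous_on Xt y" and i: "i \<in> idx S" and w: "bary_weights CARD('n) w"
  shows "closed_segment (interp_val S y i w) (y (pt S i w)) \<subseteq> y ` X"
proof -
  have "closed_segment (interp_val S y i w) (y (pt S i w)) \<subseteq> y ` simplex_of S i"
    using interp_val_in_image[OF assms] pt_in_simplex[OF w] convex_image_simplex[OF y i]
    by (intro closed_segment_subset) auto
  then show ?thesis using simplex_subset[OF i] by blast
qed

lemma outer_mean_value:
  fixes y :: "real^'n \<Rightarrow> real"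
  assumes y: "continuous_on Xt y" and i: "i \<in> idx S" and w: "bary_weights CARD('n) w"
    and U: "open U" "y ` Xt \<subseteq> U" and h: "C2_on U h"
  obtains t where "t \<in> closed_segment (interp_val S y i w) (y (pt S i w))"
    "h (y (pt S i w)) - h (interp_val S y i w) = gap S y i w * deriv h t"
proof -
  have der: "(h has_real_derivative deriv h t) (at t)" if "t \<in> U" for t
    using C2_on_real_derivs[OF U(1) h] that by metis
  show thesis
    using mean_value_segment[of "interp_val S y i w" "y (pt S i w)" h] der
      segment_in_image[OF y i w] U X_sub that
    unfolding gap_def by blast
qed

text \<open>
  The bounds on the second derivative are given at interpolated values only. They suffice since
  the interpolated values on one simplex form an interval that contains the vertex values and their
  mean, so Taylor expansion never leaves it.
\<close>

lemma outer_curvature: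
  fixes y :: "real^'n \<Rightarrow> real"
  assumes y: "continuous_on Xt y" and i: "i \<in> idx S" and w: "bary_weights CARD('n) w"
    and U: "open U" "y ` Xt \<subseteq> U" and h: "C2_on U h"
  defines "q \<equiv> (tau S)\<^sup>2 * (real CARD('n) * (gconst S y)\<^sup>2 / 8)"
  shows "(\<And>t. t \<in> interp S y ` X \<Longrightarrow> lo \<le> deriv (deriv h) t) \<Longrightarrow>
      h (interp_val S y i w) - interp_val S (\<lambda>x. h (y x)) i w \<le> q * max 0 (- lo)"
    and "(\<And>t. t \<in> interp S y ` X \<Longrightarrow> deriv (deriv h) t \<le> hi) \<Longrightarrow>
      interp_val S (\<lambda>x. h (y x)) i w - h (interp_val S y i w) \<le> q * max 0 hi"
proof -
  obtain h' h'' where h': "\<And>t. t \<in> U \<Longrightarrow> (h has_derivative blinfun_apply (h' t)) (at t)"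
    and h'': "\<And>t. t \<in> U \<Longrightarrow> (h' has_derivative blinfun_apply (h'' t)) (at t)"
    and quad: "\<And>t v. t \<in> U \<Longrightarrow> h'' t v v = deriv (deriv h) t * (norm v)\<^sup>2"
    using C2_on_real_derivs[OF U(1) h] by metis
  let ?p = "\<lambda>j. y (vert S i j)"
  let ?C = "{\<Sum>j=1..CARD('n)+1. w j *\<^sub>R ?p j | w. bary_weights CARD('n) w}"
  have C: "?C \<subseteq> interp S y ` X"
  proof
    fix t assume "t \<in> ?C"
    then obtain v where v: "bary_weights CARD('n) v" "t = interp_val S y i v"
      by (auto simp: interp_val_def)
    then show "t \<in> interp S y ` X"
      using interp_pt[OF y i v(1)] pt_in_X[OF i v(1)] by force
  qed
  also have "\<dots> \<subseteq> U" using interp_image_subset[OF y] U X_sub by blast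
  finally have CU: "?C \<subseteq> U" .
  have p: "?p j \<in> ?C" if "j \<in> {1..CARD('n)+1}" for j
    using bary_weights_vertex(1)[OF that] bary_weights_vertex(2)[OF that, of ?p]
    by (intro CollectI exI conjI) (rule sym)
  have q: "q = real CARD('n) * (tau S * gconst S y)\<^sup>2 / 8"
    by (simp add: q_def power_mult_distrib)
  have d: "norm (?p j - ?p k) \<le> tau S * gconst S y"
    if "j \<in> {1..CARD('n)+1}" "k \<in> {1..CARD('n)+1}" for j k
    using edge_difference_le_gconst[OF i that] by simp
  note prems = h' h'' convex_barycentric_combinations CU p
  note prems' = _ _ _ weights_nonneg_sum[OF w] d
  have I: "interp_val S y i w = (\<Sum>j=1..CARD('n)+1. w j *\<^sub>R ?p j)"
    "interp_val S (\<lambda>x. h (y x)) i w = (\<Sum>j=1..CARD('n)+1. w j * h (?p j))"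
    by (simp_all add: interp_val_def)
  show "h (interp_val S y i w) - interp_val S (\<lambda>x. h (y x)) i w \<le> q * max 0 (- lo)"
    if lo: "\<And>t. t \<in> interp S y ` X \<Longrightarrow> lo \<le> deriv (deriv h) t"
    unfolding I q
  proof (rule concave_gap_le[OF prems _ prems'])
    fix t and v :: real assume t: "t \<in> ?C"
    then have "lo \<le> deriv (deriv h) t" "t \<in> U" using C CU lo by blast+
    then show "lo * (norm v)\<^sup>2 \<le> h'' t v v" unfolding quad[OF \<open>t \<in> U\<close>] by (intro mult_right_mono) auto
  qed (auto simp: Suc_leI)
  show "interp_val S (\<lambda>x. h (y x)) i w - h (interp_val S y i w) \<le> q * max 0 hi"
    if hi: "\<And>t. t \<in> interp S y ` X \<Longrightarrow> deriv (deriv h) t \<le> hi"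
    unfolding I q
  proof (rule convex_gap_le[OF prems _ prems'])
    fix t and v :: real assume t: "t \<in> ?C"
    then have "deriv (deriv h) t \<le> hi" "t \<in> U" using C CU hi by blast+
    then show "h'' t v v \<le> hi * (norm v)\<^sup>2" unfolding quad[OF \<open>t \<in> U\<close>] by (intro mult_right_mono) auto
  qed (auto simp: Suc_leI)
qed

lemma outer_jensen:
  fixes y :: "real^'n \<Rightarrow> real"
  assumes y: "continuous_on Xt y" and i: "i \<in> idx S" and w: "bary_weights CARD('n) w"
    and U: "y ` Xt \<subseteq> U" and h: "\<And>J. convex J \<Longrightarrow> J \<subseteq> U \<Longrightarrow> convex_on J h"
  shows "h (interp_val S y i w) \<le> interp_val S (\<lambda>x. h (y x)) i w"
proof -
  let ?J = "y ` simplex_of S i"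
  have "convex_on ?J h"
    using simplex_subset[OF i] X_sub U by (intro h convex_image_simplex[OF y i]) blast
  moreover have "y (vert S i j) \<in> ?J" if "j \<in> {1..CARD('n)+1}" for j
    using vert_in_simplex[OF that] by (rule imageI)
  ultimately have "h (\<Sum>j\<in>{1..CARD('n)+1}. w j *\<^sub>R y (vert S i j))
      \<le> (\<Sum>j\<in>{1..CARD('n)+1}. w j * h (y (vert S i j)))"
    using weights_nonneg_sum[OF w]
    by (intro convex_on_sum) auto
  then show ?thesis by (simp add: interp_val_def)
qed

end

section \<open>Margins of sums of products and of compositions\<close>

text \<open>
  Stated for simplexes and weights rather than with \<open>interp\<close>, which is a definite description and
  denotes the interpolated value only where that value is unique.
\<close>

definition margins :: "(real^'n) simplices \<Rightarrow> (real^'n \<Rightarrow> real) \<Rightarrow> real \<Rightarrow> real \<Rightarrow> bool" where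
  "margins S \<xi> m M \<longleftrightarrow> 0 \<le> m \<and> 0 \<le> M \<and>
     (\<forall>i\<in>idx S. \<forall>w. bary_weights CARD('n) w \<longrightarrow> - m \<le> gap S \<xi> i w \<and> gap S \<xi> i w \<le> M)"

definition upper_margin :: "(real^'n) simplices \<Rightarrow> (real^'n \<Rightarrow> real) \<Rightarrow> real \<Rightarrow> bool" where
  "upper_margin S \<xi> M \<longleftrightarrow> 0 \<le> M \<and>
     (\<forall>i\<in>idx S. \<forall>w. bary_weights CARD('n) w \<longrightarrow> gap S \<xi> i w \<le> M)"

lemma margins_upper: "margins S \<xi> m M \<Longrightarrow> upper_margin S \<xi> M"
  unfolding margins_def upper_margin_def by blast

context simplicial_grid
begin

lemma margins_bounds:
  assumes "margins S \<xi> m M" "c = mk_consts S \<xi> m M" "i \<in> idx S" "bary_weights CARD('n) w"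
  shows "b_lo c \<le> \<xi> (pt S i w)" "\<xi> (pt S i w) \<le> b_hi c"
    "b_lo c \<le> interp_val S \<xi> i w" "interp_val S \<xi> i w \<le> b_hi c"
  using assms(1,3,4) interp_val_between[OF assms(3,4), of \<xi>]
  unfolding assms(2) margins_def gap_def mk_consts_def by (auto simp: algebra_simps; force)+

lemma upper_margin_bounds:
  assumes "upper_margin S \<xi> M" "c = mk_upper S \<xi> M" "i \<in> idx S" "bary_weights CARD('n) w"
  shows "\<xi> (pt S i w) \<le> b_hi c" "interp_val S \<xi> i w \<le> b_hi c"
  using assms(1,3,4) interp_val_between[OF assms(3,4), of \<xi>]
  unfolding assms(2) upper_margin_def gap_def mk_upper_def by (auto simp: algebra_simps; force)+

lemma exists_weight: obtains i w where "i \<in> idx S" "bary_weights CARD('n) w"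
  using X_nonempty X_cases by blast

lemma margins_inner_sum:
  fixes D :: "(real^'n, 'h) decomp" and c :: "(real^'n \<Rightarrow> real) \<Rightarrow> five_consts"
  assumes c: "\<And>s \<xi>. s \<in> {1..T} \<Longrightarrow> \<xi> \<in> {phi D s, psi D s} \<Longrightarrow>
    margins S \<xi> (m_lo (c \<xi>)) (m_hi (c \<xi>)) \<and> c \<xi> = mk_consts S \<xi> (m_lo (c \<xi>)) (m_hi (c \<xi>))"
  shows "margins S (inner_sum T D) (sum_m_lo T S D c) (sum_m_hi T S D c)"
proof -
  let ?g = "\<lambda>s. (tau S)\<^sup>2 * gval (c (phi D s)) * gval (c (psi D s))"
  have gval: "gval (c \<xi>) = gconst S \<xi>" if "s \<in> {1..T}" "\<xi> \<in> {phi D s, psi D s}" for s \<xi>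
  proof -
    have "c \<xi> = mk_consts S \<xi> (m_lo (c \<xi>)) (m_hi (c \<xi>))" using c[OF that] ..
    then have "gval (c \<xi>) = gval (mk_consts S \<xi> (m_lo (c \<xi>)) (m_hi (c \<xi>)))" by (rule arg_cong)
    then show ?thesis by (simp add: mk_consts_def)
  qed
  have g: "0 \<le> ?g s" if "s \<in> {1..T}" for s
    using gval[OF that] gconst_nonneg by simp
  have a: "0 \<le> a_lo (c \<xi>) (c \<eta>)" "0 \<le> a_hi (c \<xi>) (c \<eta>)"
    if s: "s \<in> {1..T}" "\<xi> \<in> {phi D s, psi D s}" "\<eta> \<in> {phi D s, psi D s}" for s \<xi> \<eta>
  proof -
    obtain i w where iw: "i \<in> idx S" "bary_weights CARD('n) w" by (rule exists_weight)
    have "b_lo (c \<eta>) \<le> \<eta> (pt S i w)" "\<eta> (pt S i w) \<le> b_hi (c \<eta>)"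
      using margins_bounds(1,2)[OF _ _ iw, of \<eta>] c[OF s(1,3)] by blast+
    then have "b_lo (c \<eta>) \<le> b_hi (c \<eta>)" by (rule order_trans)
    moreover have "0 \<le> m_lo (c \<xi>)" "0 \<le> m_hi (c \<xi>)"
      using c[OF s(1,2)] unfolding margins_def by blast+
    ultimately show "0 \<le> a_lo (c \<xi>) (c \<eta>)" "0 \<le> a_hi (c \<xi>) (c \<eta>)"
      unfolding a_lo_def a_hi_def by (blast intro: max_mult_nonneg)+
  qed
  have "- sum_m_lo T S D c \<le> gap S (inner_sum T D) i w" "gap S (inner_sum T D) i w \<le> sum_m_hi T S D c"
    if iw: "i \<in> idx S" "bary_weights CARD('n) w" for i w
  proof -
    have factor: "gap S \<xi> i w * b \<le> a_hi (c \<xi>) (c \<eta>)" "- a_lo (c \<xi>) (c \<eta>) \<le> gap S \<xi> i w * b"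
      if "s \<in> {1..T}" "\<xi> \<in> {phi D s, psi D s}" "b_lo (c \<eta>) \<le> b" "b \<le> b_hi (c \<eta>)" for s \<xi> \<eta> b
    proof -
      have "- m_lo (c \<xi>) \<le> gap S \<xi> i w" "gap S \<xi> i w \<le> m_hi (c \<xi>)" "0 \<le> m_lo (c \<xi>)" "0 \<le> m_hi (c \<xi>)"
        using c[OF that(1,2)] iw unfolding margins_def by blast+
      from mult_between[OF this that(3,4)]
      show "gap S \<xi> i w * b \<le> a_hi (c \<xi>) (c \<eta>)" "- a_lo (c \<xi>) (c \<eta>) \<le> gap S \<xi> i w * b"
        unfolding a_hi_def a_lo_def .
    qed
    have summand: "gap S (\<lambda>x. phi D s x * psi D s x) i w
          \<le> a_hi (c (phi D s)) (c (psi D s)) + a_hi (c (psi D s)) (c (phi D s)) + ?g s"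
        "- (a_lo (c (phi D s)) (c (psi D s)) + a_lo (c (psi D s)) (c (phi D s)) + ?g s)
          \<le> gap S (\<lambda>x. phi D s x * psi D s x) i w" if s: "s \<in> {1..T}" for s
    proof -
      let ?e = "gap S (phi D s) i w * psi D s (pt S i w)"
      let ?f = "gap S (psi D s) i w * interp_val S (phi D s) i w"
      have phi: "b_lo (c (phi D s)) \<le> interp_val S (phi D s) i w"
          "interp_val S (phi D s) i w \<le> b_hi (c (phi D s))"
        using margins_bounds(3,4)[OF _ _ iw, of "phi D s"] c[OF s] by blast+
      have psi: "b_lo (c (psi D s)) \<le> psi D s (pt S i w)" "psi D s (pt S i w) \<le> b_hi (c (psi D s))"
        using margins_bounds(1,2)[OF _ _ iw, of "psi D s"] c[OF s] by blast+
      have "?e \<le> a_hi (c (phi D s)) (c (psi D s))" "- a_lo (c (phi D s)) (c (psi D s)) \<le> ?e"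
        "?f \<le> a_hi (c (psi D s)) (c (phi D s))" "- a_lo (c (psi D s)) (c (phi D s)) \<le> ?f"
        by (rule factor[OF s]; use phi psi in simp)+
      moreover have "\<bar>gap S (\<lambda>x. phi D s x * psi D s x) i w - (?e + ?f)\<bar> \<le> ?g s"
        using gap_product[OF iw] gval[OF s] by simp
      ultimately show "gap S (\<lambda>x. phi D s x * psi D s x) i w
          \<le> a_hi (c (phi D s)) (c (psi D s)) + a_hi (c (psi D s)) (c (phi D s)) + ?g s"
        "- (a_lo (c (phi D s)) (c (psi D s)) + a_lo (c (psi D s)) (c (phi D s)) + ?g s)
          \<le> gap S (\<lambda>x. phi D s x * psi D s x) i w"
        by linarith+
    qed
    show "gap S (inner_sum T D) i w \<le> sum_m_hi T S D c"
      unfolding gap_inner_sum sum_m_hi_def by (intro sum_mono summand)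
    show "- sum_m_lo T S D c \<le> gap S (inner_sum T D) i w"
      unfolding gap_inner_sum sum_m_lo_def sum_negf[symmetric] by (intro sum_mono summand)
  qed
  moreover have "0 \<le> sum_m_lo T S D c" "0 \<le> sum_m_hi T S D c"
    unfolding sum_m_lo_def sum_m_hi_def by (intro sum_nonneg add_nonneg_nonneg a g; blast)+
  ultimately show ?thesis unfolding margins_def by blast
qed

text \<open>
  Nonnegativity removes the lower margins from the formula: both factors of \<open>(\<phi> - \<phi>\<^sup>I) \<psi>\<close> may be
  replaced by their upper bounds once \<open>\<psi>\<close> and the margin are nonnegative.
\<close>

lemma upper_margin_inner_sum:
  fixes D :: "(real^'n, 'h) decomp" and c :: "(real^'n \<Rightarrow> real) \<Rightarrow> three_consts"
  assumes c: "\<And>s \<xi>. s \<in> {1..T} \<Longrightarrow> \<xi> \<in> {phi D s, psi D s} \<Longrightarrow>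
      upper_margin S \<xi> (m_hi (c \<xi>)) \<and> c \<xi> = mk_upper S \<xi> (m_hi (c \<xi>))"
    and nonneg: "\<And>s \<xi> x. s \<in> {1..T} \<Longrightarrow> \<xi> \<in> {phi D s, psi D s} \<Longrightarrow> x \<in> X \<Longrightarrow> 0 \<le> \<xi> x"
  shows "upper_margin S (inner_sum T D) (sum_m_hi_nonneg T S D c)"
proof -
  let ?g = "\<lambda>s. (tau S)\<^sup>2 * gval (c (phi D s)) * gval (c (psi D s))"
  have gval: "gval (c \<xi>) = gconst S \<xi>" if "s \<in> {1..T}" "\<xi> \<in> {phi D s, psi D s}" for s \<xi>
  proof -
    have "c \<xi> = mk_upper S \<xi> (m_hi (c \<xi>))" using c[OF that] ..
    then have "gval (c \<xi>) = gval (mk_upper S \<xi> (m_hi (c \<xi>)))" by (rule arg_cong)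
    then show ?thesis by (simp add: mk_upper_def)
  qed
  have m: "0 \<le> m_hi (c \<xi>)" if "s \<in> {1..T}" "\<xi> \<in> {phi D s, psi D s}" for s \<xi>
    using c[OF that] unfolding upper_margin_def by blast
  have val: "0 \<le> \<xi> (pt S i w)" "\<xi> (pt S i w) \<le> b_hi (c \<xi>)"
      "0 \<le> interp_val S \<xi> i w" "interp_val S \<xi> i w \<le> b_hi (c \<xi>)"
    if s: "s \<in> {1..T}" "\<xi> \<in> {phi D s, psi D s}" and iw: "i \<in> idx S" "bary_weights CARD('n) w"
    for s \<xi> i w
  proof -
    show "0 \<le> \<xi> (pt S i w)" by (rule nonneg[OF s pt_in_X[OF iw]])
    show "\<xi> (pt S i w) \<le> b_hi (c \<xi>)" "interp_val S \<xi> i w \<le> b_hi (c \<xi>)"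
      using upper_margin_bounds[OF _ _ iw] c[OF s] by blast+
    show "0 \<le> interp_val S \<xi> i w"
      unfolding interp_val_def using weights_nonneg_sum(1)[OF iw(2)] nonneg[OF s vert_in_X[OF iw(1)]]
      by (intro sum_nonneg mult_nonneg_nonneg)
  qed
  have b: "0 \<le> b_hi (c \<xi>)" if "s \<in> {1..T}" "\<xi> \<in> {phi D s, psi D s}" for s \<xi>
    using exists_weight val(1,2)[OF that] by (meson order_trans)
  have g: "0 \<le> ?g s" if "s \<in> {1..T}" for s
    using gval[OF that] gconst_nonneg by simp
  have "gap S (inner_sum T D) i w \<le> sum_m_hi_nonneg T S D c"
    if iw: "i \<in> idx S" "bary_weights CARD('n) w" for i w
    unfolding gap_inner_sum sum_m_hi_nonneg_def
  proof (rule sum_mono)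
    fix s assume s: "s \<in> {1..T}"
    let ?e = "gap S (phi D s) i w * psi D s (pt S i w)"
    let ?f = "gap S (psi D s) i w * interp_val S (phi D s) i w"
    have factor: "gap S \<xi> i w * t \<le> m_hi (c \<xi>) * u"
      if "\<xi> \<in> {phi D s, psi D s}" "0 \<le> t" "t \<le> u" for \<xi> t u
    proof -
      have "gap S \<xi> i w \<le> m_hi (c \<xi>)" using c[OF s that(1)] iw unfolding upper_margin_def by blast
      then have "gap S \<xi> i w * t \<le> m_hi (c \<xi>) * t" using that(2) by (rule mult_right_mono)
      also have "\<dots> \<le> m_hi (c \<xi>) * u" using that(3) m[OF s that(1)] by (rule mult_left_mono)
      finally show ?thesis .
    qed
    have "?e \<le> m_hi (c (phi D s)) * b_hi (c (psi D s))" "?f \<le> m_hi (c (psi D s)) * b_hi (c (phi D s))"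
      by (rule factor; use val[OF s _ iw] in blast)+
    moreover have "\<bar>gap S (\<lambda>x. phi D s x * psi D s x) i w - (?e + ?f)\<bar> \<le> ?g s"
      using gap_product[OF iw] gval[OF s] by simp
    ultimately show "gap S (\<lambda>x. phi D s x * psi D s x) i w
        \<le> m_hi (c (phi D s)) * b_hi (c (psi D s)) + m_hi (c (psi D s)) * b_hi (c (phi D s)) + ?g s"
      by linarith
  qed
  moreover have "0 \<le> sum_m_hi_nonneg T S D c"
    unfolding sum_m_hi_nonneg_def by (intro sum_nonneg add_nonneg_nonneg mult_nonneg_nonneg m b g; blast)
  ultimately show ?thesis unfolding upper_margin_def by blast
qed

lemma gap_cong:
  assumes "\<And>x. x \<in> X \<Longrightarrow> \<xi> x = \<eta> x" "i \<in> idx S" "bary_weights CARD('n) w"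
  shows "gap S \<xi> i w = gap S \<eta> i w"
  using assms pt_in_X vert_in_X by (auto simp: gap_def interp_val_def intro!: sum.cong)

text \<open>
  The first bracket is the effect of the inner gap on \<open>h\<close>, the second one the gap of \<open>h\<close> itself at the
  vertex values of \<open>y\<close>.
\<close>

lemma gap_comp:
  "gap S (\<lambda>x. h (y x)) i w = (h (y (pt S i w)) - h (interp_val S y i w))
    + (h (interp_val S y i w) - interp_val S (\<lambda>x. h (y x)) i w)"
  unfolding gap_def by simp

text \<open>
  The sign conditions on the margins hold because the two derivative bounds enclose the derivative
  at some inner value and are therefore ordered.
\<close>

lemma margins_comp_H:
  assumes y: "continuous_on Xt y" "margins S y m M" and h: "in_H X Xt y h"
    and \<Phi>: "\<And>x. x \<in> Xt \<Longrightarrow> \<Phi> x = hfun h (y x)"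
  defines "q \<equiv> (tau S)\<^sup>2 * (real CARD('n) * (gconst S y)\<^sup>2 / 8)"
  shows "margins S \<Phi> (max (- M * dlo h) (m * dhi h) + q * max 0 (d2hi h S))
    (max (- m * dlo h) (M * dhi h) + q * max 0 (- d2lo h S))"
proof -
  have U: "open (hdom h)" "y ` Xt \<subseteq> hdom h" and C2: "C2_on (hdom h) (hfun h)"
    and d: "\<And>t. t \<in> y ` X \<Longrightarrow> dlo h \<le> deriv (hfun h) t \<and> deriv (hfun h) t \<le> dhi h"
    using h unfolding in_H_def H1_def by blast+
  have d2: "d2lo h S \<le> deriv (deriv (hfun h)) t" "deriv (deriv (hfun h)) t \<le> d2hi h S"
    if "t \<in> interp S y ` X" for t
    using h coll that unfolding in_H_def by blast+
  have mM: "0 \<le> m" "0 \<le> M" using y(2) unfolding margins_def by blast+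
  have q: "0 \<le> q" unfolding q_def by simp
  have dd: "dlo h \<le> dhi h" using d X_nonempty by (meson ex_in_conv imageI order_trans)
  have "- (max (- M * dlo h) (m * dhi h) + q * max 0 (d2hi h S)) \<le> gap S \<Phi> i w"
    "gap S \<Phi> i w \<le> max (- m * dlo h) (M * dhi h) + q * max 0 (- d2lo h S)"
    if iw: "i \<in> idx S" "bary_weights CARD('n) w" for i w
  proof -
    obtain t where t: "t \<in> closed_segment (interp_val S y i w) (y (pt S i w))"
      and eq: "hfun h (y (pt S i w)) - hfun h (interp_val S y i w) = gap S y i w * deriv (hfun h) t"
      using outer_mean_value[OF y(1) iw U C2] by blast
    have "t \<in> y ` X" using t segment_in_image[OF y(1) iw] by blast
    then have slope: "dlo h \<le> deriv (hfun h) t" "deriv (hfun h) t \<le> dhi h" using d by blast+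
    have gap: "- m \<le> gap S y i w" "gap S y i w \<le> M" using y(2) iw unfolding margins_def by blast+
    note mult_between[OF gap mM slope]
    moreover have "hfun h (interp_val S y i w) - interp_val S (\<lambda>x. hfun h (y x)) i w \<le> q * max 0 (- d2lo h S)"
      using outer_curvature(1)[OF y(1) iw U C2] d2(1) unfolding q_def by blast
    moreover have "interp_val S (\<lambda>x. hfun h (y x)) i w - hfun h (interp_val S y i w) \<le> q * max 0 (d2hi h S)"
      using outer_curvature(2)[OF y(1) iw U C2] d2(2) unfolding q_def by blast
    moreover have "gap S \<Phi> i w = gap S (\<lambda>x. hfun h (y x)) i w"
      using \<Phi> X_sub by (intro gap_cong iw) blast
    ultimately show "- (max (- M * dlo h) (m * dhi h) + q * max 0 (d2hi h S)) \<le> gap S \<Phi> i w"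
      "gap S \<Phi> i w \<le> max (- m * dlo h) (M * dhi h) + q * max 0 (- d2lo h S)"
      unfolding gap_comp eq max.commute[of "- M * dlo h"] max.commute[of "- m * dlo h"]
      by linarith+
  qed
  moreover have "0 \<le> max (M * dhi h) (- m * dlo h)" "0 \<le> max (m * dhi h) (- M * dlo h)"
    by (intro max_mult_nonneg mM dd)+
  then have "0 \<le> max (- M * dlo h) (m * dhi h) + q * max 0 (d2hi h S)"
    "0 \<le> max (- m * dlo h) (M * dhi h) + q * max 0 (- d2lo h S)"
    using q by (simp_all add: max.commute)
  ultimately show ?thesis unfolding margins_def by blast
qed

lemma upper_margin_comp_ndec:
  assumes y: "continuous_on Xt y" "upper_margin S y M" and h: "in_H_ndec X Xt y h"
    and \<Phi>: "\<And>x. x \<in> Xt \<Longrightarrow> \<Phi> x = hfun h (y x)"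
  defines "q \<equiv> (tau S)\<^sup>2 * (real CARD('n) * (gconst S y)\<^sup>2 / 8)"
  shows "upper_margin S \<Phi> (M * ndec_dhi h S + q * max 0 (- ndec_d2lo h S))"
proof -
  have U: "open (hdom h)" "y ` Xt \<subseteq> hdom h" and C2: "C2_on (hdom h) (hfun h)"
    and mono: "mono_on (hdom h) (hfun h)"
    using h unfolding in_H_ndec_def H1_def by blast+
  let ?d = "deriv (hfun h)"
  have d2: "ndec_d2lo h S \<le> deriv ?d t" if "t \<in> interp S y ` X" for t
    using h coll that unfolding in_H_ndec_def by blast
  have d: "?d t \<le> ndec_dhi h S" if "Inf (interp S y ` X) \<le> t" "t \<le> Sup (y ` X)" "t \<in> hdom h" for t
    using h coll that unfolding in_H_ndec_def by fastforce
  have M: "0 \<le> M" using y(2) unfolding upper_margin_def by blast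
  have q: "0 \<le> q" unfolding q_def by simp
  have "compact (y ` X)"
    by (rule compact_continuous_image[OF continuous_on_subset[OF y(1) X_sub] compact_X])
  then have "bounded (y ` X)" by (rule compact_imp_bounded)
  then have bdd: "bdd_above (y ` X)" "bdd_below (interp S y ` X)"
    using bdd_below_mono[OF bounded_imp_bdd_below interp_image_subset[OF y(1)]]
    by (simp_all add: bounded_imp_bdd_above)
  have Inf_le: "Inf (interp S y ` X) \<le> interp_val S y i w"
    if iw: "i \<in> idx S" "bary_weights CARD('n) w" for i w
    using interp_pt[OF y(1) iw] pt_in_X[OF iw] bdd(2) by (metis cInf_lower imageI)
  have Sup_ge: "t \<le> Sup (y ` X)" if "t \<in> y ` X" for t using that bdd(1) by (rule cSup_upper)
  have yU: "y ` X \<subseteq> hdom h" using U X_sub by blast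
  \<comment> \<open>The bound dominates the derivative of a nondecreasing function at some interpolated value.\<close>
  have nonneg: "0 \<le> ndec_dhi h S"
  proof -
    obtain i w where iw: "i \<in> idx S" "bary_weights CARD('n) w" by (rule exists_weight)
    let ?t = "interp_val S y i w"
    have t: "?t \<in> y ` X" using segment_in_image[OF y(1) iw] by auto
    then have "?t \<in> hdom h" using yU by blast
    then have der: "(hfun h has_real_derivative ?d ?t) (at ?t)"
      using C2_on_real_derivs[OF U(1) C2] by metis
    have "0 \<le> ?d ?t"
      using mono_on_imp_deriv_nonneg[OF mono der] U(1) \<open>?t \<in> hdom h\<close> by (simp add: interior_open)
    also have "?d ?t \<le> ndec_dhi h S"
      using d Inf_le[OF iw] Sup_ge[OF t] \<open>?t \<in> hdom h\<close> by blast
    finally show ?thesis .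
  qed
  have "gap S \<Phi> i w \<le> M * ndec_dhi h S + q * max 0 (- ndec_d2lo h S)"
    if iw: "i \<in> idx S" "bary_weights CARD('n) w" for i w
  proof -
    let ?a = "interp_val S y i w" and ?b = "y (pt S i w)"
    have seg: "closed_segment ?a ?b \<subseteq> y ` X" by (rule segment_in_image[OF y(1) iw])
    have "hfun h ?b - hfun h ?a \<le> M * ndec_dhi h S"
    proof (cases "?b \<le> ?a")
      \<comment> \<open>A negative inner gap can only lower the value of a nondecreasing function.\<close>
      case True
      have "?a \<in> hdom h" "?b \<in> hdom h" using seg yU by auto
      then have "hfun h ?b \<le> hfun h ?a" using mono True by (auto simp: mono_on_def)
      then show ?thesis using mult_nonneg_nonneg[OF M nonneg] by simp
    next
      case False
      obtain t where t: "t \<in> closed_segment ?a ?b"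
        and eq: "hfun h ?b - hfun h ?a = gap S y i w * ?d t"
        using outer_mean_value[OF y(1) iw U C2] by blast
      have "?a \<le> t" using t False by (simp add: closed_segment_eq_real_ivl)
      then have "?d t \<le> ndec_dhi h S"
        using Inf_le[OF iw] Sup_ge[of t] t seg yU by (intro d) auto
      then have "gap S y i w * ?d t \<le> gap S y i w * ndec_dhi h S"
        using False by (intro mult_left_mono) (auto simp: gap_def)
      also have "\<dots> \<le> M * ndec_dhi h S"
        using y(2) iw nonneg unfolding upper_margin_def by (intro mult_right_mono) auto
      finally show ?thesis unfolding eq .
    qed
    moreover have "hfun h ?a - interp_val S (\<lambda>x. hfun h (y x)) i w \<le> q * max 0 (- ndec_d2lo h S)"
      using outer_curvature(1)[OF y(1) iw U C2] d2 unfolding q_def by blast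
    moreover have "gap S \<Phi> i w = gap S (\<lambda>x. hfun h (y x)) i w"
      using \<Phi> X_sub by (intro gap_cong iw) blast
    ultimately show ?thesis unfolding gap_comp by linarith
  qed
  then show ?thesis unfolding upper_margin_def using M q nonneg by simp
qed

text \<open>
  By Jensen's inequality the second bracket is at most 0, so only the Lipschitz estimate of the first
  one remains. The Lipschitz estimate ignores the sign of the inner gap, which is why both margins
  of the inner function are needed.
\<close>

lemma upper_margin_comp_conv:
  assumes y: "continuous_on Xt y" "margins S y m M" and h: "in_H_conv Xt y h"
    and \<Phi>: "\<And>x. x \<in> Xt \<Longrightarrow> \<Phi> x = hfun h (y x)"
  shows "upper_margin S \<Phi> (hLip h * max m M)"
proof -
  have U: "y ` Xt \<subseteq> hdom h" and conv: "\<And>J. convex J \<Longrightarrow> J \<subseteq> hdom h \<Longrightarrow> convex_on J (hfun h)"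
    and lip: "(hLip h)-lipschitz_on (hdom h) (hfun h)"
    using h unfolding in_H_conv_def H1_def by blast+
  have L: "0 \<le> hLip h" using lip by (rule lipschitz_on_nonneg)
  have "gap S \<Phi> i w \<le> hLip h * max m M" if iw: "i \<in> idx S" "bary_weights CARD('n) w" for i w
  proof -
    let ?a = "interp_val S y i w" and ?b = "y (pt S i w)"
    have "closed_segment ?a ?b \<subseteq> hdom h" using segment_in_image[OF y(1) iw] U X_sub by blast
    then have "?a \<in> hdom h" "?b \<in> hdom h" by auto
    then have "hfun h ?b - hfun h ?a \<le> hLip h * \<bar>gap S y i w\<bar>"
      using lipschitz_onD[OF lip, of ?b ?a] by (simp add: dist_real_def gap_def)
    also have "\<bar>gap S y i w\<bar> \<le> max m M" using y(2) iw unfolding margins_def by fastforce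
    then have "hLip h * \<bar>gap S y i w\<bar> \<le> hLip h * max m M" using L by (rule mult_left_mono)
    finally have "hfun h ?b - hfun h ?a \<le> hLip h * max m M" .
    moreover have "hfun h ?a \<le> interp_val S (\<lambda>x. hfun h (y x)) i w"
      using outer_jensen[OF y(1) iw U] conv by blast
    moreover have "gap S \<Phi> i w = gap S (\<lambda>x. hfun h (y x)) i w"
      using \<Phi> X_sub by (intro gap_cong iw) blast
    ultimately show ?thesis unfolding gap_comp by linarith
  qed
  moreover have "0 \<le> max m M" using y(2) unfolding margins_def by auto
  ultimately show ?thesis unfolding upper_margin_def using L by simp
qed

end

section \<open>Correctness and order of the procedures\<close>

context sampling_domain
begin

text \<open>
  The invariants of the induction over the levels. They collect what a composition step needs from
  its factors: valid margins, the remaining constants derived from them in the prescribed way, and,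
  uniformly over all simplex collections, regularity and second order.
\<close>

definition two_sided :: "(real^'n \<Rightarrow> real) \<Rightarrow> ((real^'n) simplices \<Rightarrow> five_consts) \<Rightarrow> bool" where
  "two_sided \<xi> c \<longleftrightarrow> tame \<xi> \<and>
     (\<forall>S. simplex_collection X Xt S \<longrightarrow>
        margins S \<xi> (m_lo (c S)) (m_hi (c S)) \<and> c S = mk_consts S \<xi> (m_lo (c S)) (m_hi (c S))) \<and>
     is_Oprime X Xt 2 (\<lambda>S. m_lo (c S)) \<and> is_Oprime X Xt 2 (\<lambda>S. m_hi (c S))"

definition one_sided :: "(real^'n \<Rightarrow> real) \<Rightarrow> ((real^'n) simplices \<Rightarrow> three_consts) \<Rightarrow> bool" where
  "one_sided \<xi> c \<longleftrightarrow> tame \<xi> \<and>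
     (\<forall>S. simplex_collection X Xt S \<longrightarrow>
        upper_margin S \<xi> (m_hi (c S)) \<and> c S = mk_upper S \<xi> (m_hi (c S))) \<and>
     is_Oprime X Xt 2 (\<lambda>S. m_hi (c S))"

lemma two_sided_one_sided:
  assumes "two_sided \<xi> c"
  shows "one_sided \<xi> (\<lambda>S. three_consts.truncate (c S))"
proof -
  have m: "m_hi (three_consts.truncate k) = m_hi k" for k :: five_consts
    by (simp add: three_consts.truncate_def)
  have "three_consts.truncate (c S) = mk_upper S \<xi> (m_hi (c S))"
    if "c S = mk_consts S \<xi> (m_lo (c S)) (m_hi (c S))" for S
    by (subst that) (simp add: mk_consts_def mk_upper_def three_consts.truncate_def)
  then show ?thesis
    using assms unfolding two_sided_def one_sided_def m by (auto intro: margins_upper)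
qed

lemma one_sided_bounded:
  assumes "one_sided \<xi> c"
  shows "is_Oprime X Xt 0 (\<lambda>S. b_hi (c S))" "is_Oprime X Xt 0 (\<lambda>S. gval (c S))"
proof -
  have t: "tame \<xi>" and o: "is_Oprime X Xt 2 (\<lambda>S. m_hi (c S))"
    and c: "\<And>S. simplex_collection X Xt S \<Longrightarrow> c S = mk_upper S \<xi> (m_hi (c S))"
    using assms unfolding one_sided_def by blast+
  have eq: "b_hi (c S) = Max (\<xi> ` verts S) + m_hi (c S)" "gval (c S) = gconst S \<xi>"
    if "simplex_collection X Xt S" for S
    by (subst c[OF that], simp add: mk_upper_def)+
  show "is_Oprime X Xt 0 (\<lambda>S. b_hi (c S))"
    by (rule is_Oprime_mono[OF is_Oprime_add[OF vertex_extrema_bounded(1)[OF t] is_Oprime_weaken[OF o]]])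
      (simp add: eq)
  show "is_Oprime X Xt 0 (\<lambda>S. gval (c S))"
    by (rule is_Oprime_mono[OF gconst_bounded[OF t]]) (simp add: eq)
qed

lemma two_sided_bounded:
  assumes "two_sided \<xi> c"
  shows "is_Oprime X Xt 0 (\<lambda>S. b_hi (c S))" "is_Oprime X Xt 0 (\<lambda>S. b_lo (c S))"
    "is_Oprime X Xt 0 (\<lambda>S. gval (c S))"
proof -
  show "is_Oprime X Xt 0 (\<lambda>S. b_hi (c S))" "is_Oprime X Xt 0 (\<lambda>S. gval (c S))"
    using one_sided_bounded[OF two_sided_one_sided[OF assms]] by (simp_all add: three_consts.truncate_def)
  have t: "tame \<xi>" and o: "is_Oprime X Xt 2 (\<lambda>S. m_lo (c S))"
    and c: "\<And>S. simplex_collection X Xt S \<Longrightarrow> c S = mk_consts S \<xi> (m_lo (c S)) (m_hi (c S))"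
    using assms unfolding two_sided_def by blast+
  have eq: "b_lo (c S) = Min (\<xi> ` verts S) + - m_lo (c S)" if "simplex_collection X Xt S" for S
    by (subst c[OF that], simp add: mk_consts_def)
  show "is_Oprime X Xt 0 (\<lambda>S. b_lo (c S))"
    by (rule is_Oprime_mono[OF is_Oprime_add[OF vertex_extrema_bounded(2)[OF t]
            is_Oprime_uminus[OF is_Oprime_weaken[OF o]]]])
      (simp add: eq)
qed

lemma two_sided_step0:
  assumes "\<xi> \<in> class_F T X Xt K 1"
  shows "two_sided \<xi> (\<lambda>S. step0 K \<xi> S)"
proof -
  obtain lo hi where C2: "C2_on Xt \<xi>" and K: "known_d2 K \<xi> = Some (lo, hi)"
    and d2: "\<And>x \<nu>. x \<in> X \<Longrightarrow> norm \<nu> = 1 \<Longrightarrow>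
      lo \<le> deriv (deriv (\<lambda>t. \<xi> (x + t *\<^sub>R \<nu>))) 0 \<and> deriv (deriv (\<lambda>t. \<xi> (x + t *\<^sub>R \<nu>))) 0 \<le> hi"
    using assms by (auto simp: class_F1_def)
  define mlo where "mlo S = real CARD('n) * (tau S)\<^sup>2 / 8 * max 0 hi" for S :: "(real^'n) simplices"
  define mhi where "mhi S = real CARD('n) * (tau S)\<^sup>2 / 8 * max 0 (- lo)" for S :: "(real^'n) simplices"
  have eq: "step0 K \<xi> S = mk_consts S \<xi> (mlo S) (mhi S)"
    "m_lo (step0 K \<xi> S) = mlo S" "m_hi (step0 K \<xi> S) = mhi S" for S
    by (simp_all add: step0_def K mlo_def mhi_def mk_consts_def)
  have "margins S \<xi> (mlo S) (mhi S)" if "simplex_collection X Xt S" for S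
  proof -
    interpret simplicial_grid X Xt S using that by (rule grid)
    show ?thesis
      unfolding margins_def mlo_def mhi_def using gap_C2[OF C2 _ _ d2] by (simp add: d2)
  qed
  moreover have "is_Oprime X Xt 2 (\<lambda>S. (tau S)\<^sup>2 * (real CARD('n) / 8 * k))" for k
    by (intro is_Oprime_mult_bounded is_Oprime_tau_power is_Oprime_const)
  from this[of "max 0 hi"] this[of "max 0 (- lo)"]
  have "is_Oprime X Xt 2 mlo" "is_Oprime X Xt 2 mhi"
    by (simp_all add: mlo_def[abs_def] mhi_def[abs_def] mult_ac)
  ultimately show ?thesis
    unfolding two_sided_def eq(2,3) using eq(1) tame_C2[OF C2] by blast
qed

lemma is_Oprime_sum_margins:
  fixes D :: "(real^'n, 'h) decomp"
  assumes "\<And>s \<xi>. s \<in> {1..T} \<Longrightarrow> \<xi> \<in> {phi D s, psi D s} \<Longrightarrow> two_sided \<xi> (\<lambda>S. c S \<xi>)"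
  shows "is_Oprime X Xt 2 (\<lambda>S. sum_m_lo T S D (c S))" "is_Oprime X Xt 2 (\<lambda>S. sum_m_hi T S D (c S))"
proof -
  have a: "is_Oprime X Xt 2 (\<lambda>S. a_lo (c S \<xi>) (c S \<eta>))" "is_Oprime X Xt 2 (\<lambda>S. a_hi (c S \<xi>) (c S \<eta>))"
    if "two_sided \<xi> (\<lambda>S. c S \<xi>)" "two_sided \<eta> (\<lambda>S. c S \<eta>)" for \<xi> \<eta>
    unfolding a_lo_def a_hi_def using that(1)
    by (intro is_Oprime_max is_Oprime_mult_bounded is_Oprime_uminus two_sided_bounded[OF that(2)];
        simp add: two_sided_def)+
  have g: "is_Oprime X Xt 2 (\<lambda>S. (tau S)\<^sup>2 * gval (c S \<xi>) * gval (c S \<eta>))"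
    if "two_sided \<xi> (\<lambda>S. c S \<xi>)" "two_sided \<eta> (\<lambda>S. c S \<eta>)" for \<xi> \<eta>
    by (intro is_Oprime_mult_bounded(1) is_Oprime_tau_power two_sided_bounded(3)[OF that(1)]
        two_sided_bounded(3)[OF that(2)])
  have factors: "two_sided (phi D s) (\<lambda>S. c S (phi D s))" "two_sided (psi D s) (\<lambda>S. c S (psi D s))"
    if "s \<in> {1..T}" for s
    using assms[OF that] by blast+
  show "is_Oprime X Xt 2 (\<lambda>S. sum_m_lo T S D (c S))" "is_Oprime X Xt 2 (\<lambda>S. sum_m_hi T S D (c S))"
    unfolding sum_m_lo_def sum_m_hi_def
    by (intro is_Oprime_sum is_Oprime_add a g factors; assumption)+
qed

lemma is_Oprime_curvature_term:
  assumes "tame y" "is_Oprime X Xt 0 k"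
  shows "is_Oprime X Xt 2 (\<lambda>S. (tau S)\<^sup>2 * (real CARD('n) * (gconst S y)\<^sup>2 / 8) * max 0 (k S))"
proof -
  have "is_Oprime X Xt 2 (\<lambda>S. (tau S)\<^sup>2 * (gconst S y * (gconst S y * (real CARD('n) / 8))) * max 0 (k S))"
    by (intro is_Oprime_mult_bounded(1) is_Oprime_tau_power is_Oprime_max is_Oprime_const
        gconst_bounded assms)
  then show ?thesis by (simp add: power2_eq_square mult_ac)
qed

text \<open>
  Every summand of the new margins contains exactly one factor of second order, namely an old margin
  or \<open>\<tau>\<^sup>2\<close>, times bounded factors. The same holds for the other two composition steps.
\<close>

lemma two_sided_compose:
  assumes c: "\<And>s \<xi>. s \<in> {1..T} \<Longrightarrow> \<xi> \<in> {phi D s, psi D s} \<Longrightarrow> two_sided \<xi> (\<lambda>S. c S \<xi>)"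
    and h: "in_H X Xt (inner_sum T D) (outer D)"
    and \<Phi>: "\<And>x. x \<in> Xt \<Longrightarrow> \<Phi> x = hfun (outer D) (inner_sum T D x)"
  shows "two_sided \<Phi> (\<lambda>S. compose_A T S \<Phi> D (c S))"
proof -
  let ?y = "inner_sum T D" and ?h = "outer D"
  let ?q = "\<lambda>S. (tau S)\<^sup>2 * (real CARD('n) * (gconst S ?y)\<^sup>2 / 8)"
  define mlo where "mlo S = max (- sum_m_hi T S D (c S) * dlo ?h) (sum_m_lo T S D (c S) * dhi ?h)
    + ?q S * max 0 (d2hi ?h S)" for S
  define mhi where "mhi S = max (- sum_m_lo T S D (c S) * dlo ?h) (sum_m_hi T S D (c S) * dhi ?h)
    + ?q S * max 0 (- d2lo ?h S)" for S
  have eq: "compose_A T S \<Phi> D (c S) = mk_consts S \<Phi> (mlo S) (mhi S)"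
    "m_lo (compose_A T S \<Phi> D (c S)) = mlo S" "m_hi (compose_A T S \<Phi> D (c S)) = mhi S" for S
    by (simp_all add: compose_A_def Let_def mlo_def mhi_def mk_consts_def)
  have y: "tame ?y"
    using c by (intro tame_inner_sum) (simp_all add: two_sided_def)
  have "tame (\<lambda>x. hfun ?h (?y x))"
    using h unfolding in_H_def H1_def by (intro tame_comp_C2[OF y, of "hdom ?h"]) auto
  then have tame: "tame \<Phi>" using \<Phi> by (rule tame_cong)
  have margins: "margins S \<Phi> (mlo S) (mhi S)" if S: "simplex_collection X Xt S" for S
  proof -
    interpret simplicial_grid X Xt S using S by (rule grid)
    have "margins S ?y (sum_m_lo T S D (c S)) (sum_m_hi T S D (c S))"
      using c S by (intro margins_inner_sum) (simp add: two_sided_def)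
    then show ?thesis
      unfolding mlo_def mhi_def by (rule margins_comp_H[OF tame_continuous[OF y] _ h \<Phi>])
  qed
  obtain C where C: "\<And>S. simplex_collection X Xt S \<Longrightarrow> \<bar>d2lo ?h S\<bar> + \<bar>d2hi ?h S\<bar> < C"
    using h unfolding in_H_def by blast
  have b: "is_Oprime X Xt 0 (\<lambda>S. d2lo ?h S)" "is_Oprime X Xt 0 (\<lambda>S. d2hi ?h S)"
    by (rule is_Oprime_bounded[of _ C]; use C in fastforce)+
  note o = is_Oprime_sum_margins[of T D c, OF c]
  have "is_Oprime X Xt 2 mlo" "is_Oprime X Xt 2 mhi"
    unfolding mlo_def[abs_def] mhi_def[abs_def]
    by (intro is_Oprime_add is_Oprime_max is_Oprime_mult_bounded(1)[OF _ is_Oprime_const]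
        is_Oprime_uminus is_Oprime_curvature_term y b o; assumption)+
  then show ?thesis
    unfolding two_sided_def eq(2,3) using eq(1) tame margins by blast
qed

lemma one_sided_compose_ndec:
  assumes c: "\<And>s \<xi>. s \<in> {1..T} \<Longrightarrow> \<xi> \<in> {phi D s, psi D s} \<Longrightarrow> one_sided \<xi> (\<lambda>S. c S \<xi>)"
    and nonneg: "\<And>s \<xi>. s \<in> {1..T} \<Longrightarrow> \<xi> \<in> {phi D s, psi D s} \<Longrightarrow> \<xi> \<in> nonneg_funs Xt"
    and h: "in_H_ndec X Xt (inner_sum T D) (outer D)"
    and \<Phi>: "\<And>x. x \<in> Xt \<Longrightarrow> \<Phi> x = hfun (outer D) (inner_sum T D x)"
  shows "one_sided \<Phi> (\<lambda>S. compose_ndec T S \<Phi> D (c S))"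
proof -
  let ?y = "inner_sum T D" and ?h = "outer D"
  define mhi where "mhi S = sum_m_hi_nonneg T S D (c S) * ndec_dhi ?h S
    + (tau S)\<^sup>2 * (real CARD('n) * (gconst S ?y)\<^sup>2 / 8) * max 0 (- ndec_d2lo ?h S)" for S
  have eq: "compose_ndec T S \<Phi> D (c S) = mk_upper S \<Phi> (mhi S)"
    "m_hi (compose_ndec T S \<Phi> D (c S)) = mhi S" for S
    by (simp_all add: compose_ndec_def Let_def mhi_def mk_upper_def)
  have y: "tame ?y"
    using c by (intro tame_inner_sum) (simp_all add: one_sided_def)
  have "tame (\<lambda>x. hfun ?h (?y x))"
    using h unfolding in_H_ndec_def H1_def by (intro tame_comp_C2[OF y, of "hdom ?h"]) auto
  then have tame: "tame \<Phi>" using \<Phi> by (rule tame_cong)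
  have margin: "upper_margin S \<Phi> (mhi S)" if S: "simplex_collection X Xt S" for S
  proof -
    interpret simplicial_grid X Xt S using S by (rule grid)
    have "upper_margin S ?y (sum_m_hi_nonneg T S D (c S))"
    proof (rule upper_margin_inner_sum)
      show "0 \<le> \<xi> x" if "s \<in> {1..T}" "\<xi> \<in> {phi D s, psi D s}" "x \<in> X" for s \<xi> x
        using nonneg[OF that(1,2)] that(3) X_sub unfolding nonneg_funs_def by blast
    qed (use c S in \<open>simp add: one_sided_def\<close>)
    then show ?thesis
      unfolding mhi_def by (rule upper_margin_comp_ndec[OF tame_continuous[OF y] _ h \<Phi>])
  qed
  obtain C where C: "\<And>S. simplex_collection X Xt S \<Longrightarrow> \<bar>ndec_d2lo ?h S\<bar> + \<bar>ndec_dhi ?h S\<bar> < C"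
    using h unfolding in_H_ndec_def by blast
  have b: "is_Oprime X Xt 0 (\<lambda>S. ndec_d2lo ?h S)" "is_Oprime X Xt 0 (\<lambda>S. ndec_dhi ?h S)"
    by (rule is_Oprime_bounded[of _ C]; use C in fastforce)+
  have o: "is_Oprime X Xt 2 (\<lambda>S. m_hi (c S \<xi>))" "is_Oprime X Xt 0 (\<lambda>S. b_hi (c S \<xi>))"
      "is_Oprime X Xt 0 (\<lambda>S. gval (c S \<xi>))"
    if "s \<in> {1..T}" "\<xi> \<in> {phi D s, psi D s}" for s \<xi>
    using c[OF that] one_sided_bounded[OF c[OF that]] unfolding one_sided_def by blast+
  have "is_Oprime X Xt 2 (\<lambda>S. sum_m_hi_nonneg T S D (c S))"
    unfolding sum_m_hi_nonneg_def
    by (intro is_Oprime_sum is_Oprime_add is_Oprime_mult_bounded(1) is_Oprime_tau_power o) auto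
  then have "is_Oprime X Xt 2 mhi"
    unfolding mhi_def[abs_def]
    by (intro is_Oprime_add is_Oprime_mult_bounded(1) is_Oprime_uminus is_Oprime_curvature_term y b)
  then show ?thesis
    unfolding one_sided_def eq(2) using eq(1) tame margin by blast
qed

lemma one_sided_compose_conv:
  assumes c: "\<And>s \<xi>. s \<in> {1..T} \<Longrightarrow> \<xi> \<in> {phi D s, psi D s} \<Longrightarrow> two_sided \<xi> (\<lambda>S. c S \<xi>)"
    and h: "in_H_conv Xt (inner_sum T D) (outer D)"
    and \<Phi>: "\<And>x. x \<in> Xt \<Longrightarrow> \<Phi> x = hfun (outer D) (inner_sum T D x)"
  shows "one_sided \<Phi> (\<lambda>S. compose_conv T S \<Phi> D (c S))"
proof -
  let ?y = "inner_sum T D" and ?h = "outer D"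
  define mhi where "mhi S = hLip ?h * max (sum_m_lo T S D (c S)) (sum_m_hi T S D (c S))" for S
  have eq: "compose_conv T S \<Phi> D (c S) = mk_upper S \<Phi> (mhi S)"
    "m_hi (compose_conv T S \<Phi> D (c S)) = mhi S" for S
    by (simp_all add: compose_conv_def mhi_def mk_upper_def)
  have y: "tame ?y"
    using c by (intro tame_inner_sum) (simp_all add: two_sided_def)
  have "tame (\<lambda>x. hfun ?h (?y x))"
    using h unfolding in_H_conv_def H1_def by (intro tame_comp_lipschitz[OF y, of "hdom ?h"]) auto
  then have tame: "tame \<Phi>" using \<Phi> by (rule tame_cong)
  have margin: "upper_margin S \<Phi> (mhi S)" if S: "simplex_collection X Xt S" for S
  proof -
    interpret simplicial_grid X Xt S using S by (rule grid)
    have "margins S ?y (sum_m_lo T S D (c S)) (sum_m_hi T S D (c S))"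
      using c S by (intro margins_inner_sum) (simp add: two_sided_def)
    then show ?thesis
      unfolding mhi_def by (rule upper_margin_comp_conv[OF tame_continuous[OF y] _ h \<Phi>])
  qed
  have "is_Oprime X Xt 2 mhi"
    unfolding mhi_def[abs_def]
    by (intro is_Oprime_mult_bounded(2)[OF _ is_Oprime_const] is_Oprime_max
        is_Oprime_sum_margins[of T D c, OF c])
  then show ?thesis
    unfolding one_sided_def eq(2) using eq(1) tame margin by blast
qed

lemma two_sided_proc_A:
  assumes "\<Phi> \<in> class_F T X Xt K N"
  shows "two_sided \<Phi> (\<lambda>S. proc_A T X Xt K \<Phi> N S)"
  using assms
proof (induction N arbitrary: \<Phi>)
  case (Suc N)
  show ?case
  proof (cases N)
    case 0
    then show ?thesis using Suc.prems two_sided_step0[of \<Phi> T K] by simp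
  next
    case (Suc M)
    with Suc.prems obtain D where D: "known_F K (Suc (Suc M)) \<Phi> = Some D"
      and factors: "\<forall>s\<in>{1..T}. phi D s \<in> class_F T X Xt K (Suc M) \<and> psi D s \<in> class_F T X Xt K (Suc M)"
      and h: "in_H X Xt (inner_sum T D) (outer D)"
      and \<Phi>: "\<forall>x\<in>Xt. \<Phi> x = hfun (outer D) (inner_sum T D x)"
      by auto
    have "two_sided \<Phi> (\<lambda>S. compose_A T S \<Phi> D
        (\<lambda>\<xi>. if \<xi> \<in> class_F T X Xt K 1 then step0 K \<xi> S else proc_A T X Xt K \<xi> (Suc M) S))"
    proof (rule two_sided_compose[OF _ h])
      fix s \<xi> assume "s \<in> {1..T}" "\<xi> \<in> {phi D s, psi D s}"
      then have "\<xi> \<in> class_F T X Xt K (Suc M)" using factors by blast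
      then show "two_sided \<xi> (\<lambda>S. if \<xi> \<in> class_F T X Xt K 1 then step0 K \<xi> S
          else proc_A T X Xt K \<xi> (Suc M) S)"
        using two_sided_step0[of \<xi> T K] Suc.IH[of \<xi>] Suc
        by (cases "\<xi> \<in> class_F T X Xt K 1") simp_all
    qed (use \<Phi> in blast)
    then show ?thesis using Suc D by simp
  qed
qed simp

lemma class_F_plus_nonneg: "\<Phi> \<in> class_F_plus T X Xt K N \<Longrightarrow> \<Phi> \<in> nonneg_funs Xt"
  by (induction T X Xt K N rule: class_F_plus.induct) (auto simp: class_F_ndec_def class_F_conv_def)

lemma one_sided_proc_A_plus:
  assumes "\<Phi> \<in> class_F_plus T X Xt K N"
  shows "one_sided \<Phi> (\<lambda>S. proc_A_plus T X Xt K \<Phi> N S)"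
  using assms
proof (induction N arbitrary: \<Phi>)
  case (Suc N)
  show ?case
  proof (cases N)
    case 0
    then show ?thesis
      using Suc.prems two_sided_one_sided[OF two_sided_step0[of \<Phi> T K]] by simp
  next
    case (Suc M)
    let ?G = "class_F_plus T X Xt K (Suc M)"
    show ?thesis
    proof (cases "uses_ndec T X Xt K \<Phi> (Suc (Suc M))")
      case True
      then obtain D where D: "known_ndec K (Suc (Suc M)) \<Phi> = Some D"
        and factors: "\<forall>s\<in>{1..T}. phi D s \<in> ?G \<and> psi D s \<in> ?G"
        and h: "in_H_ndec X Xt (inner_sum T D) (outer D)"
        and \<Phi>: "\<forall>x\<in>Xt. \<Phi> x = hfun (outer D) (inner_sum T D x)"
        unfolding uses_ndec_def class_F_ndec_def by auto
      have "one_sided \<Phi> (\<lambda>S. compose_ndec T S \<Phi> D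
          (\<lambda>\<xi>. if \<xi> \<in> class_F T X Xt K 1 then three_consts.truncate (step0 K \<xi> S)
               else if \<xi> \<in> class_F T X Xt K (Suc M)
                    then three_consts.truncate (proc_A T X Xt K \<xi> (Suc M) S)
               else proc_A_plus T X Xt K \<xi> (Suc M) S))"
      proof (rule one_sided_compose_ndec[OF _ _ h])
        fix s \<xi> assume "s \<in> {1..T}" "\<xi> \<in> {phi D s, psi D s}"
        then have \<xi>: "\<xi> \<in> ?G" using factors by blast
        then show "\<xi> \<in> nonneg_funs Xt" by (rule class_F_plus_nonneg)
        show "one_sided \<xi> (\<lambda>S. if \<xi> \<in> class_F T X Xt K 1 then three_consts.truncate (step0 K \<xi> S)
               else if \<xi> \<in> class_F T X Xt K (Suc M)
                    then three_consts.truncate (proc_A T X Xt K \<xi> (Suc M) S)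
               else proc_A_plus T X Xt K \<xi> (Suc M) S)"
          using two_sided_one_sided[OF two_sided_step0[of \<xi> T K]]
            two_sided_one_sided[OF two_sided_proc_A[of \<xi> T K "Suc M"]] Suc.IH[of \<xi>] Suc \<xi>
          by (cases "\<xi> \<in> class_F T X Xt K 1"; cases "\<xi> \<in> class_F T X Xt K (Suc M)") simp_all
      qed (use \<Phi> in blast)
      then show ?thesis using Suc D True by simp
    next
      case False
      then have "\<Phi> \<in> class_F_conv T X Xt K (Suc (Suc M))"
        using Suc.prems Suc unfolding uses_ndec_def by auto
      then obtain D where D: "known_conv K (Suc (Suc M)) \<Phi> = Some D"
        and factors: "\<forall>s\<in>{1..T}. phi D s \<in> class_F T X Xt K (Suc M) \<and> psi D s \<in> class_F T X Xt K (Suc M)"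
        and h: "in_H_conv Xt (inner_sum T D) (outer D)"
        and \<Phi>: "\<forall>x\<in>Xt. \<Phi> x = hfun (outer D) (inner_sum T D x)"
        unfolding class_F_conv_def by auto
      have "one_sided \<Phi> (\<lambda>S. compose_conv T S \<Phi> D
          (\<lambda>\<xi>. if \<xi> \<in> class_F T X Xt K 1 then step0 K \<xi> S else proc_A T X Xt K \<xi> (Suc M) S))"
      proof (rule one_sided_compose_conv[OF _ h])
        fix s \<xi> assume "s \<in> {1..T}" "\<xi> \<in> {phi D s, psi D s}"
        then have "\<xi> \<in> class_F T X Xt K (Suc M)" using factors by blast
        then show "two_sided \<xi> (\<lambda>S. if \<xi> \<in> class_F T X Xt K 1 then step0 K \<xi> S
            else proc_A T X Xt K \<xi> (Suc M) S)"
          using two_sided_step0[of \<xi> T K] two_sided_proc_A[of \<xi> T K "Suc M"]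
          by (cases "\<xi> \<in> class_F T X Xt K 1") simp_all
      qed (use \<Phi> in blast)
      then show ?thesis using Suc D False by simp
    qed
  qed
qed simp

end

theorem theorem2:
  fixes X Xt :: "(real^'n) set" and T N :: nat
    and K :: "(real^'n) knowledge" and \<Phi> :: "real^'n \<Rightarrow> real"
  assumes "bounded X" and "closed X" and "0 \<in> X"
    and "bounded Xt" and "open Xt" and "X \<subseteq> Xt"
    and "1 \<le> T" and "1 \<le> N"
    and "\<Phi> \<in> class_F_plus T X Xt K N"
  shows "(\<forall>S. simplex_collection X Xt S \<longrightarrow>
            is_upper_margin X S \<Phi> (m_hi (proc_A_plus T X Xt K \<Phi> N S))) \<and>
         is_Oprime X Xt 2 (\<lambda>S. m_hi (proc_A_plus T X Xt K \<Phi> N S))"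
proof -
  interpret sampling_domain X Xt
    using assms by unfold_locales (auto simp: compact_eq_bounded_closed)
  have plus: "one_sided \<Phi> (\<lambda>S. proc_A_plus T X Xt K \<Phi> N S)"
    by (rule one_sided_proc_A_plus) fact
  have "is_upper_margin X S \<Phi> (m_hi (proc_A_plus T X Xt K \<Phi> N S))"
    if S: "simplex_collection X Xt S" for S
  proof -
    interpret simplicial_grid X Xt S using S by (rule grid)
    have cont: "continuous_on Xt \<Phi>" and margin: "upper_margin S \<Phi> (m_hi (proc_A_plus T X Xt K \<Phi> N S))"
      using plus S tame_continuous unfolding one_sided_def by blast+
    have "\<Phi> x - interp S \<Phi> x \<le> m_hi (proc_A_plus T X Xt K \<Phi> N S)" if "x \<in> X" for x
      using that
    proof (rule X_cases)
      fix i w assume iw: "i \<in> idx S" "bary_weights CARD('n) w" "x = pt S i w"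
      then show ?thesis
        using margin interp_pt[OF cont iw(1,2)] unfolding upper_margin_def gap_def by auto
    qed
    then show ?thesis
      using margin unfolding is_upper_margin_def upper_margin_def by blast
  qed
  then show ?thesis using plus unfolding one_sided_def by blast
qed

end
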